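(* Let $L$ be a finite dimensional Lie algebra over a field $\mathbb{F}$, and let $\bar L$ be a cover (covering Lie algebra) of $L$. Then $$L\wedge L\;\cong\;\bar L^{2}$$ as Lie algebras, where $\bar L^2=[\bar L,\bar L]$.
   Context: Lie algebras are over a fixed field $\mathbb{F}$. For a Lie algebra $K$, $K^2=[K,K]$ is its derived subalgebra and $Z(K)$ its center. The (nonabelian) tensor square $L\otimes L$ of $L$ is the Lie algebra over $\mathbb{F}$ generated by symbols $l\otimes k$ ($l,k\in L$) subject to the relations, for all $c\in\mathbb{F}$ and $l,l',k,k'\in L$: (i) $c(l\otimes k)=cl\otimes k=l\otimes ck$; (ii) $(l+l')\otimes k=l\otimes k+l'\otimes k$ and $l\otimes(k+k')=l\otimes k+l\otimes k'$; (iii) $[l,l']\otimes k=l\otimes[l',k]-l'\otimes[l,k]$ and $l\otimes[k,k']=[k',l]\otimes k-[k,l]\otimes k'$; (iv) $[\,l\otimes k,\;l'\otimes k'\,]=-[k,l]\otimes[l',k']$. $L\,\square\, L$ is the submodule of $L\otimes L$ generated by all elements $l\otimes l$, $l\in L$ (it is an ideal). The exterior square of $L$ is the quotient $L\wedge L=(L\otimes L)/(L\,\square\, L)$. A pair of Lie algebras $(K,M)$ is a defining pair for $L$ if there is an exact sequence of Lie algebras $0\to M\to K\to L\to 0$ with (the image of) $M\subseteq Z(K)\cap K^2$. When $L$ is finite dimensional, the dimension of $K$ over all defining pairs is bounded; a $K$ of maximal dimension occurring in a defining pair is called a cover (covering Lie algebra) of $L$, and the corresponding $M$ is the Schur multiplier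 $\mathcal{M}(L)$ of $L$. *)

theory Defs
  imports "HOL-Algebra.AbelCoset" "Jordan_Normal_Form.Missing_VectorSpace"
begin

section \<open>Lie algebras\<close>

text \<open>The fields \<open>mult\<close> and \<open>one\<close>, inherited from \<open>ring\<close> through \<open>module\<close>, play no role
  (as for the library's modules and vector spaces).\<close>

record ('f, 'a) lie_algebra = "('f, 'a) module" +
  bracket :: "['a, 'a] \<Rightarrow> 'a" (\<open>\<lbrakk>_,/ _\<rbrakk>\<index>\<close>)

locale lie_algebra = vectorspace F L
  for F :: "('f, 'r) ring_scheme" and L :: "('f, 'a) lie_algebra" (structure) +
  assumes bracket_closed:
      "\<lbrakk>x \<in> carrier L; y \<in> carrier L\<rbrakk> \<Longrightarrow> \<lbrakk>x, y\<rbrakk>\<^bsub>L\<^esub> \<in> carrier L"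
    and bracket_add_left:
      "\<lbrakk>x \<in> carrier L; y \<in> carrier L; z \<in> carrier L\<rbrakk> \<Longrightarrow>
        \<lbrakk>x \<oplus>\<^bsub>L\<^esub> y, z\<rbrakk>\<^bsub>L\<^esub> = \<lbrakk>x, z\<rbrakk>\<^bsub>L\<^esub> \<oplus>\<^bsub>L\<^esub> \<lbrakk>y, z\<rbrakk>\<^bsub>L\<^esub>"
    and bracket_add_right:
      "\<lbrakk>x \<in> carrier L; y \<in> carrier L; z \<in> carrier L\<rbrakk> \<Longrightarrow>
        \<lbrakk>x, y \<oplus>\<^bsub>L\<^esub> z\<rbrakk>\<^bsub>L\<^esub> = \<lbrakk>x, y\<rbrakk>\<^bsub>L\<^esub> \<oplus>\<^bsub>L\<^esub> \<lbrakk>x, z\<rbrakk>\<^bsub>L\<^esub>"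
    and bracket_smult_left:
      "\<lbrakk>c \<in> carrier F; x \<in> carrier L; y \<in> carrier L\<rbrakk> \<Longrightarrow>
        \<lbrakk>c \<odot>\<^bsub>L\<^esub> x, y\<rbrakk>\<^bsub>L\<^esub> = c \<odot>\<^bsub>L\<^esub> \<lbrakk>x, y\<rbrakk>\<^bsub>L\<^esub>"
    and bracket_smult_right:
      "\<lbrakk>c \<in> carrier F; x \<in> carrier L; y \<in> carrier L\<rbrakk> \<Longrightarrow>
        \<lbrakk>x, c \<odot>\<^bsub>L\<^esub> y\<rbrakk>\<^bsub>L\<^esub> = c \<odot>\<^bsub>L\<^esub> \<lbrakk>x, y\<rbrakk>\<^bsub>L\<^esub>"
    and bracket_self:
      "x \<in> carrier L \<Longrightarrow> \<lbrakk>x, x\<rbrakk>\<^bsub>L\<^esub> = \<zero>\<^bsub>L\<^esub>"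
    and jacobi:
      "\<lbrakk>x \<in> carrier L; y \<in> carrier L; z \<in> carrier L\<rbrakk> \<Longrightarrow>
        \<lbrakk>x, \<lbrakk>y, z\<rbrakk>\<^bsub>L\<^esub>\<rbrakk>\<^bsub>L\<^esub> \<oplus>\<^bsub>L\<^esub> \<lbrakk>y, \<lbrakk>z, x\<rbrakk>\<^bsub>L\<^esub>\<rbrakk>\<^bsub>L\<^esub> \<oplus>\<^bsub>L\<^esub> \<lbrakk>z, \<lbrakk>x, y\<rbrakk>\<^bsub>L\<^esub>\<rbrakk>\<^bsub>L\<^esub> = \<zero>\<^bsub>L\<^esub>"

definition lie_hom ::
  "('f, 'r) ring_scheme \<Rightarrow> ('f, 'a) lie_algebra \<Rightarrow> ('f, 'b) lie_algebra \<Rightarrow> ('a \<Rightarrow> 'b) set"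
  where "lie_hom F K L = {h \<in> module_hom F K L.
    \<forall>x \<in> carrier K. \<forall>y \<in> carrier K. h \<lbrakk>x, y\<rbrakk>\<^bsub>K\<^esub> = \<lbrakk>h x, h y\<rbrakk>\<^bsub>L\<^esub>}"

definition lie_isomorphic ::
  "('f, 'r) ring_scheme \<Rightarrow> ('f, 'a) lie_algebra \<Rightarrow> ('f, 'b) lie_algebra \<Rightarrow> bool"
  where "lie_isomorphic F K L \<longleftrightarrow> (\<exists>h \<in> lie_hom F K L. bij_betw h (carrier K) (carrier L))"

definition lie_derived :: "('f, 'r) ring_scheme \<Rightarrow> ('f, 'a) lie_algebra \<Rightarrow> ('f, 'a) lie_algebra"
  where "lie_derived F K = K\<lparr>carrier :=
    LinearCombinations.module.span F K {\<lbrakk>x, y\<rbrakk>\<^bsub>K\<^esub> | x y. x \<in> carrier K \<and> y \<in> carrier K}\<rparr>"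

definition lie_center :: "('f, 'a) lie_algebra \<Rightarrow> 'a set"
  where "lie_center K = {z \<in> carrier K. \<forall>x \<in> carrier K. \<lbrakk>z, x\<rbrakk>\<^bsub>K\<^esub> = \<zero>\<^bsub>K\<^esub>}"

text \<open>The quotient by an ideal, on the additive cosets; the operations are as in \<open>FactRing\<close>.\<close>

definition lie_quotient :: "('f, 'a) lie_algebra \<Rightarrow> 'a set \<Rightarrow> ('f, 'a set) lie_algebra"
  where "lie_quotient K I =
    \<lparr>carrier = a_rcosets\<^bsub>K\<^esub> I, mult = undefined, one = undefined, zero = I, add = set_add K,
     smult = (\<lambda>c A. \<Union>a\<in>A. I +>\<^bsub>K\<^esub> (c \<odot>\<^bsub>K\<^esub> a)),
     bracket = (\<lambda>A B. \<Union>a\<in>A. \<Union>b\<in>B. I +>\<^bsub>K\<^esub> \<lbrakk>a, b\<rbrakk>\<^bsub>K\<^esub>)\<rparr>"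


section \<open>Nonabelian tensor square and exterior square\<close>

text \<open>The Lie algebra presented by generators and relations is the set of all formal Lie algebra
  expressions in the generators modulo the least congruence that contains the Lie algebra axioms and
  the defining relations.\<close>

datatype ('f, 'l) tensor_term =
    TGen 'l 'l
  | TZero
  | TAdd "('f, 'l) tensor_term" "('f, 'l) tensor_term"
  | TNeg "('f, 'l) tensor_term"
  | TScale 'f "('f, 'l) tensor_term"
  | TBracket "('f, 'l) tensor_term" "('f, 'l) tensor_term"

inductive_set tensor_terms ::
  "('f, 'r) ring_scheme \<Rightarrow> ('f, 'l) lie_algebra \<Rightarrow> ('f, 'l) tensor_term set"
  for F :: "('f, 'r) ring_scheme" and L :: "('f, 'l) lie_algebra" where
  "\<lbrakk>l \<in> carrier L; k \<in> carrier L\<rbrakk> \<Longrightarrow> TGen l k \<in> tensor_terms F L"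
| "TZero \<in> tensor_terms F L"
| "\<lbrakk>s \<in> tensor_terms F L; t \<in> tensor_terms F L\<rbrakk> \<Longrightarrow> TAdd s t \<in> tensor_terms F L"
| "t \<in> tensor_terms F L \<Longrightarrow> TNeg t \<in> tensor_terms F L"
| "\<lbrakk>c \<in> carrier F; t \<in> tensor_terms F L\<rbrakk> \<Longrightarrow> TScale c t \<in> tensor_terms F L"
| "\<lbrakk>s \<in> tensor_terms F L; t \<in> tensor_terms F L\<rbrakk> \<Longrightarrow> TBracket s t \<in> tensor_terms F L"

inductive tensor_eq ::
  "('f, 'r) ring_scheme \<Rightarrow> ('f, 'l) lie_algebra \<Rightarrow>
    ('f, 'l) tensor_term \<Rightarrow> ('f, 'l) tensor_term \<Rightarrow> bool"
  for F :: "('f, 'r) ring_scheme" and L :: "('f, 'l) lie_algebra" where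
  \<comment> \<open>congruence\<close>
  te_refl: "t \<in> tensor_terms F L \<Longrightarrow> tensor_eq F L t t"
| te_sym: "tensor_eq F L s t \<Longrightarrow> tensor_eq F L t s"
| te_trans: "\<lbrakk>tensor_eq F L s t; tensor_eq F L t u\<rbrakk> \<Longrightarrow> tensor_eq F L s u"
| te_cong_add: "\<lbrakk>tensor_eq F L s s'; tensor_eq F L t t'\<rbrakk> \<Longrightarrow>
    tensor_eq F L (TAdd s t) (TAdd s' t')"
| te_cong_neg: "tensor_eq F L t t' \<Longrightarrow> tensor_eq F L (TNeg t) (TNeg t')"
| te_cong_scale: "\<lbrakk>c \<in> carrier F; tensor_eq F L t t'\<rbrakk> \<Longrightarrow>
    tensor_eq F L (TScale c t) (TScale c t')"
| te_cong_bracket: "\<lbrakk>tensor_eq F L s s'; tensor_eq F L t t'\<rbrakk> \<Longrightarrow>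
    tensor_eq F L (TBracket s t) (TBracket s' t')"
  \<comment> \<open>vector space axioms\<close>
| te_add_assoc: "\<lbrakk>s \<in> tensor_terms F L; t \<in> tensor_terms F L; u \<in> tensor_terms F L\<rbrakk> \<Longrightarrow>
    tensor_eq F L (TAdd (TAdd s t) u) (TAdd s (TAdd t u))"
| te_add_comm: "\<lbrakk>s \<in> tensor_terms F L; t \<in> tensor_terms F L\<rbrakk> \<Longrightarrow>
    tensor_eq F L (TAdd s t) (TAdd t s)"
| te_add_zero: "t \<in> tensor_terms F L \<Longrightarrow> tensor_eq F L (TAdd TZero t) t"
| te_add_neg: "t \<in> tensor_terms F L \<Longrightarrow> tensor_eq F L (TAdd (TNeg t) t) TZero"
| te_scale_add_left: "\<lbrakk>c \<in> carrier F; d \<in> carrier F; t \<in> tensor_terms F L\<rbrakk> \<Longrightarrow>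
    tensor_eq F L (TScale (c \<oplus>\<^bsub>F\<^esub> d) t) (TAdd (TScale c t) (TScale d t))"
| te_scale_add_right: "\<lbrakk>c \<in> carrier F; s \<in> tensor_terms F L; t \<in> tensor_terms F L\<rbrakk> \<Longrightarrow>
    tensor_eq F L (TScale c (TAdd s t)) (TAdd (TScale c s) (TScale c t))"
| te_scale_mult: "\<lbrakk>c \<in> carrier F; d \<in> carrier F; t \<in> tensor_terms F L\<rbrakk> \<Longrightarrow>
    tensor_eq F L (TScale (c \<otimes>\<^bsub>F\<^esub> d) t) (TScale c (TScale d t))"
| te_scale_one: "t \<in> tensor_terms F L \<Longrightarrow> tensor_eq F L (TScale \<one>\<^bsub>F\<^esub> t) t"
  \<comment> \<open>Lie algebra axioms\<close>
| te_bracket_add_left: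
    "\<lbrakk>s \<in> tensor_terms F L; t \<in> tensor_terms F L; u \<in> tensor_terms F L\<rbrakk> \<Longrightarrow>
    tensor_eq F L (TBracket (TAdd s t) u) (TAdd (TBracket s u) (TBracket t u))"
| te_bracket_add_right:
    "\<lbrakk>s \<in> tensor_terms F L; t \<in> tensor_terms F L; u \<in> tensor_terms F L\<rbrakk> \<Longrightarrow>
    tensor_eq F L (TBracket s (TAdd t u)) (TAdd (TBracket s t) (TBracket s u))"
| te_bracket_scale_left: "\<lbrakk>c \<in> carrier F; s \<in> tensor_terms F L; t \<in> tensor_terms F L\<rbrakk> \<Longrightarrow>
    tensor_eq F L (TBracket (TScale c s) t) (TScale c (TBracket s t))"
| te_bracket_scale_right: "\<lbrakk>c \<in> carrier F; s \<in> tensor_terms F L; t \<in> tensor_terms F L\<rbrakk> \<Longrightarrow>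
    tensor_eq F L (TBracket s (TScale c t)) (TScale c (TBracket s t))"
| te_bracket_self: "t \<in> tensor_terms F L \<Longrightarrow> tensor_eq F L (TBracket t t) TZero"
| te_jacobi: "\<lbrakk>s \<in> tensor_terms F L; t \<in> tensor_terms F L; u \<in> tensor_terms F L\<rbrakk> \<Longrightarrow>
    tensor_eq F L
      (TAdd (TAdd (TBracket s (TBracket t u)) (TBracket t (TBracket u s)))
        (TBracket u (TBracket s t)))
      TZero"
  \<comment> \<open>defining relations of the tensor square\<close>
| te_smult_left: "\<lbrakk>c \<in> carrier F; l \<in> carrier L; k \<in> carrier L\<rbrakk> \<Longrightarrow>
    tensor_eq F L (TScale c (TGen l k)) (TGen (c \<odot>\<^bsub>L\<^esub> l) k)"
| te_smult_right: "\<lbrakk>c \<in> carrier F; l \<in> carrier L; k \<in> carrier L\<rbrakk> \<Longrightarrow>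
    tensor_eq F L (TScale c (TGen l k)) (TGen l (c \<odot>\<^bsub>L\<^esub> k))"
| te_gen_add_left: "\<lbrakk>l \<in> carrier L; l' \<in> carrier L; k \<in> carrier L\<rbrakk> \<Longrightarrow>
    tensor_eq F L (TGen (l \<oplus>\<^bsub>L\<^esub> l') k) (TAdd (TGen l k) (TGen l' k))"
| te_gen_add_right: "\<lbrakk>l \<in> carrier L; k \<in> carrier L; k' \<in> carrier L\<rbrakk> \<Longrightarrow>
    tensor_eq F L (TGen l (k \<oplus>\<^bsub>L\<^esub> k')) (TAdd (TGen l k) (TGen l k'))"
| te_gen_bracket_left: "\<lbrakk>l \<in> carrier L; l' \<in> carrier L; k \<in> carrier L\<rbrakk> \<Longrightarrow>
    tensor_eq F L (TGen \<lbrakk>l, l'\<rbrakk>\<^bsub>L\<^esub> k) (TAdd (TGen l \<lbrakk>l', k\<rbrakk>\<^bsub>L\<^esub>) (TNeg (TGen l' \<lbrakk>l, k\<rbrakk>\<^bsub>L\<^esub>)))"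
| te_gen_bracket_right: "\<lbrakk>l \<in> carrier L; k \<in> carrier L; k' \<in> carrier L\<rbrakk> \<Longrightarrow>
    tensor_eq F L (TGen l \<lbrakk>k, k'\<rbrakk>\<^bsub>L\<^esub>) (TAdd (TGen \<lbrakk>k', l\<rbrakk>\<^bsub>L\<^esub> k) (TNeg (TGen \<lbrakk>k, l\<rbrakk>\<^bsub>L\<^esub> k')))"
| te_bracket_gen:
    "\<lbrakk>l \<in> carrier L; k \<in> carrier L; l' \<in> carrier L; k' \<in> carrier L\<rbrakk> \<Longrightarrow>
    tensor_eq F L (TBracket (TGen l k) (TGen l' k')) (TNeg (TGen \<lbrakk>k, l\<rbrakk>\<^bsub>L\<^esub> \<lbrakk>l', k'\<rbrakk>\<^bsub>L\<^esub>))"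

definition tensor_class ::
  "('f, 'r) ring_scheme \<Rightarrow> ('f, 'l) lie_algebra \<Rightarrow>
    ('f, 'l) tensor_term \<Rightarrow> ('f, 'l) tensor_term set"
  where "tensor_class F L t = {s. tensor_eq F L t s}"

definition tensor_square ::
  "('f, 'r) ring_scheme \<Rightarrow> ('f, 'l) lie_algebra \<Rightarrow> ('f, ('f, 'l) tensor_term set) lie_algebra"
  where "tensor_square F L =
    \<lparr>carrier = tensor_class F L ` tensor_terms F L, mult = undefined, one = undefined,
     zero = tensor_class F L TZero,
     add = (\<lambda>A B. \<Union>a\<in>A. \<Union>b\<in>B. tensor_class F L (TAdd a b)),
     smult = (\<lambda>c A. \<Union>a\<in>A. tensor_class F L (TScale c a)),
     bracket = (\<lambda>A B. \<Union>a\<in>A. \<Union>b\<in>B. tensor_class F L (TBracket a b))\<rparr>"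

text \<open>The ideal \<open>L \<box> L\<close>.\<close>

definition diagonal_ideal ::
  "('f, 'r) ring_scheme \<Rightarrow> ('f, 'l) lie_algebra \<Rightarrow> ('f, 'l) tensor_term set set"
  where "diagonal_ideal F L = LinearCombinations.module.span F (tensor_square F L)
    {tensor_class F L (TGen l l) | l. l \<in> carrier L}"

definition exterior_square ::
  "('f, 'r) ring_scheme \<Rightarrow> ('f, 'l) lie_algebra \<Rightarrow> ('f, ('f, 'l) tensor_term set set) lie_algebra"
  where "exterior_square F L = lie_quotient (tensor_square F L) (diagonal_ideal F L)"


section \<open>Covers\<close>

definition defining_pair ::
  "('f, 'r) ring_scheme \<Rightarrow> ('f, 'l) lie_algebra \<Rightarrow>
    ('f, 'k) lie_algebra \<Rightarrow> ('f, 'm) lie_algebra \<Rightarrow> bool"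
  where "defining_pair F L K M \<longleftrightarrow> lie_algebra F K \<and> lie_algebra F M \<and>
    (\<exists>i p. i \<in> lie_hom F M K \<and> inj_on i (carrier M) \<and>
      p \<in> lie_hom F K L \<and> p ` carrier K = carrier L \<and>
      i ` carrier M = {x \<in> carrier K. p x = \<zero>\<^bsub>L\<^esub>} \<and>
      i ` carrier M \<subseteq> lie_center K \<inter> carrier (lie_derived F K))"

text \<open>A HOL formula cannot quantify over all types, so the competing pairs \<open>(K', M')\<close> are taken
  with carriers in the type \<open>nat \<Rightarrow> 'f\<close>. This loses nothing: if \<open>L\<close> is finite dimensional, then so is
  the first component of each of its defining pairs (and hence \<open>dim\<close> is meaningful), because
  \<open>K/Z(K)\<close>, then \<open>K\<^sup>2\<close>, then \<open>M \<subseteq> K\<^sup>2\<close> are finite dimensional; and every finite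
  dimensional Lie algebra over \<open>F\<close> is isomorphic to one whose underlying space is \<open>F\<^sup>n\<close>,
  the set of functions \<open>{..<n} \<rightarrow>\<^sub>E carrier F\<close>. Likewise \<open>M\<close> may be taken in the type of \<open>K\<close>,
  as it can be replaced by its image in \<open>K\<close>.\<close>

definition lie_cover ::
  "('f, 'r) ring_scheme \<Rightarrow> ('f, 'l) lie_algebra \<Rightarrow> ('f, 'k) lie_algebra \<Rightarrow> bool"
  where "lie_cover F L K \<longleftrightarrow>
    (\<exists>M :: ('f, 'k) lie_algebra. defining_pair F L K M) \<and>
    (\<forall>(K' :: ('f, nat \<Rightarrow> 'f) lie_algebra) (M' :: ('f, nat \<Rightarrow> 'f) lie_algebra).
      defining_pair F L K' M' \<longrightarrow> vectorspace.dim F K' \<le> vectorspace.dim F K)"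

end

theory Submission
  imports Defs
begin

text \<open>Let \<open>p : K \<rightarrow> L\<close> be the projection of the cover. Since its kernel is central, \<open>p x \<otimes> p y \<mapsto> \<lbrakk>x, y\<rbrakk>\<close>
  defines a surjective homomorphism \<open>\<phi>\<close> from the tensor square onto \<open>K\<^sup>2\<close>, and \<open>\<phi>\<close> kills the
  diagonal ideal \<open>D\<close>. If some \<open>t\<close> with \<open>\<phi> t = 0\<close> were outside \<open>D\<close>, take a linear functional \<open>f\<close> on
  the tensor square that vanishes on \<open>D\<close> and has \<open>f t = 1\<close>. Then \<open>(x, y) \<mapsto> f (p x \<otimes> p y)\<close> is a
  2-cocycle, and the derived subalgebra of the central extension \<open>K \<times> F\<close> it defines is
  \<open>{(\<phi> v, f v)}\<close>. This contains \<open>(\<phi> t, f t) = (0, 1)\<close> and hence the whole kernel of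
  \<open>K \<times> F \<rightarrow> L\<close>, so \<open>K \<times> F\<close> belongs to a defining pair although its dimension exceeds that of \<open>K\<close>.\<close>

section \<open>Linear algebra\<close>

text \<open>Maximality of \<open>K\<close> is tested only against enlargements by one dimension.
  This avoids free presentations and any formula for the dimension of the multiplier: a single
  element of the kernel of \<open>\<phi>\<close> off the diagonal already produces a competitor that
  is too large. The enlarged kernel stays inside the derived subalgebra because \<open>ker p\<close>
  lies in the image of \<open>\<phi>\<close>: an element \<open>(x, a)\<close> with
  \<open>p x = 0\<close> differs from some \<open>(\<phi> v, f v)\<close> by a multiple of
  \<open>(0, 1)\<close>.

  Two obstacles shape the rest. Comparing dimensions is meaningful only in finite dimension, which
  \<open>lie_cover\<close> does not state for \<open>K\<close>. It is derived from the tensor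
  square, which is finite dimensional along with \<open>L\<close> and whose image contains
  \<open>ker p\<close>. Moreover, the competitor consists of pairs, whereas those that
  \<open>lie_cover\<close> speaks of consist of functions \<open>nat \<Rightarrow> 'f\<close>, so
  its structure has to be moved along an injection.\<close>

context vectorspace
begin

lemma subspaceI:
  assumes "U \<subseteq> carrier V" "\<zero>\<^bsub>V\<^esub> \<in> U"
    and "\<And>v w. v \<in> U \<Longrightarrow> w \<in> U \<Longrightarrow> v \<oplus>\<^bsub>V\<^esub> w \<in> U"
    and "\<And>c v. c \<in> carrier K \<Longrightarrow> v \<in> U \<Longrightarrow> c \<odot>\<^bsub>V\<^esub> v \<in> U"
  shows "subspace K U V"
  unfolding subspace_def
proof
  show "vectorspace K V" ..
  show "submodule K U V"
    using assms by (intro submodule.intro module_axioms) auto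
qed

lemma subspaceD:
  assumes "subspace K U V"
  shows "U \<subseteq> carrier V" "\<zero>\<^bsub>V\<^esub> \<in> U"
    and "\<And>v w. v \<in> U \<Longrightarrow> w \<in> U \<Longrightarrow> v \<oplus>\<^bsub>V\<^esub> w \<in> U"
    and "\<And>c v. c \<in> carrier K \<Longrightarrow> v \<in> U \<Longrightarrow> c \<odot>\<^bsub>V\<^esub> v \<in> U"
    and "\<And>v. v \<in> U \<Longrightarrow> \<ominus>\<^bsub>V\<^esub> v \<in> U"
proof -
  have sub: "submodule K U V" using assms by simp
  show carr: "U \<subseteq> carrier V" and "\<zero>\<^bsub>V\<^esub> \<in> U"
    using sub by (auto dest: submodule.subset submodule.zero_closed)
  show "v \<oplus>\<^bsub>V\<^esub> w \<in> U" if "v \<in> U" "w \<in> U" for v w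
    using sub that by (rule submodule.m_closed)
  show smult: "c \<odot>\<^bsub>V\<^esub> v \<in> U" if "c \<in> carrier K" "v \<in> U" for c v
    using sub that by (rule submodule.smult_closed)
  show "\<ominus>\<^bsub>V\<^esub> v \<in> U" if "v \<in> U" for v
    using smult[of "\<ominus>\<^bsub>K\<^esub> \<one>\<^bsub>K\<^esub>" v] that carr by (auto simp: smult_minus_1)
qed

lemma span_induct:
  assumes "v \<in> span S" "S \<subseteq> carrier V"
    and "P \<zero>\<^bsub>V\<^esub>" "\<And>v. v \<in> S \<Longrightarrow> P v"
    and "\<And>v w. \<lbrakk>v \<in> carrier V; w \<in> carrier V; P v; P w\<rbrakk> \<Longrightarrow> P (v \<oplus>\<^bsub>V\<^esub> w)"
    and "\<And>c v. \<lbrakk>c \<in> carrier K; v \<in> carrier V; P v\<rbrakk> \<Longrightarrow> P (c \<odot>\<^bsub>V\<^esub> v)"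
  shows "P v"
proof -
  have "subspace K {v \<in> carrier V. P v} V"
    using assms by (intro subspaceI) auto
  moreover have "S \<subseteq> {v \<in> carrier V. P v}" using assms by auto
  ultimately have "span S \<subseteq> {v \<in> carrier V. P v}"
    by (intro span_is_subset) auto
  then show ?thesis using assms(1) by auto
qed

text \<open>Each vector receives one arbitrarily chosen coefficient family over a finite spanning
  set, enumerated by \<open>e\<close>. The vector can be recovered from its coefficients, so the
  choice is injective although nothing makes it linear. The target type is that of the competitors
  in \<open>lie_cover\<close>.\<close>

lemma fin_dim_inj_coordinates:
  assumes fin_dim
  obtains g :: "'c \<Rightarrow> nat \<Rightarrow> 'a" where "inj_on g (carrier V)"
proof -
  obtain A where A: "finite A" "A \<subseteq> carrier V" "span A = carrier V"
    using assms unfolding fin_dim_def by auto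
  have "\<exists>a. a \<in> A \<rightarrow> carrier K \<and> lincomb a A = v" if "v \<in> carrier V" for v
    using finite_in_span[of A v] that A by auto
  then obtain co where co: "\<And>v. v \<in> carrier V \<Longrightarrow> co v \<in> A \<rightarrow> carrier K \<and> lincomb (co v) A = v"
    by metis
  obtain e where e: "e ` {..<card A} = A"
    using ex_bij_betw_nat_finite[OF A(1)] by (auto simp: bij_betw_def atLeast0LessThan)
  have "inj_on (\<lambda>v i. co v (e i)) (carrier V)"
  proof (rule inj_onI)
    fix v w
    assume v: "v \<in> carrier V" and w: "w \<in> carrier V"
      and eq: "(\<lambda>i. co v (e i)) = (\<lambda>i. co w (e i))"
    have "co v x = co w x" if "x \<in> A" for x
      using that e fun_cong[OF eq] by (metis imageE)
    then have "lincomb (co v) A = lincomb (co w) A"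
      using A co w by (intro lincomb_cong) auto
    then show "v = w" using co v w by simp
  qed
  then show thesis by (rule that)
qed

text \<open>Zorn's lemma gives a subspace \<open>U\<close> maximal among those that contain
  \<open>D\<close> and miss \<open>t\<close>. Maximality makes \<open>U\<close> a hyperplane
  complementary to the line through \<open>t\<close>, and \<open>f v\<close> is the coefficient of
  \<open>t\<close> in \<open>v\<close> modulo \<open>U\<close>.\<close>

lemma separating_functional:
  assumes D: "subspace K D V" and t: "t \<in> carrier V" "t \<notin> D"
  obtains f where "f \<in> carrier V \<rightarrow> carrier K"
    and "\<And>v w. \<lbrakk>v \<in> carrier V; w \<in> carrier V\<rbrakk> \<Longrightarrow> f (v \<oplus>\<^bsub>V\<^esub> w) = f v \<oplus>\<^bsub>K\<^esub> f w"
    and "\<And>c v. \<lbrakk>c \<in> carrier K; v \<in> carrier V\<rbrakk> \<Longrightarrow> f (c \<odot>\<^bsub>V\<^esub> v) = c \<otimes>\<^bsub>K\<^esub> f v"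
    and "\<And>v. v \<in> D \<Longrightarrow> f v = \<zero>\<^bsub>K\<^esub>" and "f t = \<one>\<^bsub>K\<^esub>"
proof -
  define \<A> where "\<A> = {U. subspace K U V \<and> D \<subseteq> U \<and> t \<notin> U}"
  have "\<Union>\<C> \<in> \<A>" if "\<C> \<noteq> {}" "subset.chain \<A> \<C>" for \<C>
  proof -
    have in_\<A>: "U \<in> \<A>" if "U \<in> \<C>" for U
      using \<open>subset.chain \<A> \<C>\<close> that by (auto simp: subset.chain_def)
    have in_sub: "subspace K U V" if "U \<in> \<C>" for U
      using in_\<A>[OF that] by (simp add: \<A>_def)
    have larger: "\<exists>W\<in>\<C>. U \<subseteq> W \<and> U' \<subseteq> W" if "U \<in> \<C>" "U' \<in> \<C>" for U U'
    proof -
      have "U \<subseteq> U' \<or> U' \<subseteq> U"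
        using \<open>subset.chain \<A> \<C>\<close> that by (meson subset.chain_def subset_chain_def)
      then show ?thesis using that by blast
    qed
    have "subspace K (\<Union>\<C>) V"
    proof (rule subspaceI)
      show "\<Union>\<C> \<subseteq> carrier V" by (intro Union_least subspaceD(1) in_sub)
      show "\<zero>\<^bsub>V\<^esub> \<in> \<Union>\<C>" using subspaceD(2)[OF in_sub] \<open>\<C> \<noteq> {}\<close> by blast
      show "c \<odot>\<^bsub>V\<^esub> v \<in> \<Union>\<C>" if "c \<in> carrier K" "v \<in> \<Union>\<C>" for c v
        using that(2) subspaceD(4)[OF in_sub that(1)] by blast
      show "v \<oplus>\<^bsub>V\<^esub> w \<in> \<Union>\<C>" if vw: "v \<in> \<Union>\<C>" "w \<in> \<Union>\<C>" for v w
      proof -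
        obtain U U' where U: "U \<in> \<C>" "v \<in> U" "U' \<in> \<C>" "w \<in> U'" using vw by auto
        then obtain W where "W \<in> \<C>" "v \<in> W" "w \<in> W" using larger by blast
        then show ?thesis using subspaceD(3)[OF in_sub] by blast
      qed
    qed
    then show ?thesis using in_\<A> \<open>\<C> \<noteq> {}\<close> by (auto simp: \<A>_def)
  qed
  moreover have "\<A> \<noteq> {}" using D t by (auto simp: \<A>_def)
  ultimately have "\<exists>U\<in>\<A>. \<forall>W\<in>\<A>. U \<subseteq> W \<longrightarrow> W = U"
    by (intro subset_Zorn_nonempty)
  then obtain U where "U \<in> \<A>" and U_max: "\<And>W. W \<in> \<A> \<Longrightarrow> U \<subseteq> W \<Longrightarrow> W = U"
    by blast
  then have U: "subspace K U V" "D \<subseteq> U" "t \<notin> U" by (auto simp: \<A>_def)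
  note UD = subspaceD[OF U(1)]
  have carr: "u \<in> carrier V" if "u \<in> U" for u using that UD(1) by auto
  have inv_smult: "v = inv\<^bsub>K\<^esub> c \<odot>\<^bsub>V\<^esub> w"
    if "c \<in> carrier K" "c \<noteq> \<zero>\<^bsub>K\<^esub>" "v \<in> carrier V" "c \<odot>\<^bsub>V\<^esub> v = w" for c v w
    using mult_inverse that by auto
  have zero: "c = \<zero>\<^bsub>K\<^esub>" if "c \<in> carrier K" "c \<odot>\<^bsub>V\<^esub> t \<in> U" for c
  proof (rule ccontr)
    assume "c \<noteq> \<zero>\<^bsub>K\<^esub>"
    then have "t = inv\<^bsub>K\<^esub> c \<odot>\<^bsub>V\<^esub> (c \<odot>\<^bsub>V\<^esub> t)"
      using that(1) t(1) by (intro inv_smult) auto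
    moreover have "inv\<^bsub>K\<^esub> c \<odot>\<^bsub>V\<^esub> (c \<odot>\<^bsub>V\<^esub> t) \<in> U"
      using UD(4) that \<open>c \<noteq> \<zero>\<^bsub>K\<^esub>\<close> by auto
    ultimately show False using U(3) by (simp only:)
  qed
  \<comment> \<open>\<open>c\<close> is the coefficient of \<open>t\<close> in \<open>v\<close>
    modulo \<open>U\<close>. Its existence comes from the maximality of \<open>U\<close>, its
    uniqueness from \<open>zero\<close>.\<close>
  define Q where "Q v c \<longleftrightarrow> c \<in> carrier K \<and> (\<exists>u\<in>U. v = u \<oplus>\<^bsub>V\<^esub> c \<odot>\<^bsub>V\<^esub> t)" for v c
  have Q_zero: "Q u \<zero>\<^bsub>K\<^esub>" if "u \<in> U" for u
    unfolding Q_def using that carr t by (auto intro!: bexI[of _ u])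
  have Q_ex: "\<exists>c. Q v c" if v: "v \<in> carrier V" for v
  proof (cases "v \<in> U")
    case True
    then show ?thesis using Q_zero by auto
  next
    case False
    \<comment> \<open>\<open>U + F v\<close> properly contains \<open>U\<close> and therefore cannot
      miss \<open>t\<close>. In the resulting expression for \<open>t\<close> the coefficient of
      \<open>v\<close> is nonzero, as \<open>t\<close> is not in \<open>U\<close>; solving for
      \<open>v\<close> shows that \<open>v\<close> is a multiple of \<open>t\<close> modulo
      \<open>U\<close>.\<close>
    define W where "W = {u \<oplus>\<^bsub>V\<^esub> c \<odot>\<^bsub>V\<^esub> v | u c. u \<in> U \<and> c \<in> carrier K}"
    have "subspace K W V"
    proof (rule subspaceI)
      show "W \<subseteq> carrier V" using carr v by (auto simp: W_def)
      show "\<zero>\<^bsub>V\<^esub> \<in> W" unfolding W_def using UD(2) v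
        by (auto intro!: exI[of _ "\<zero>\<^bsub>V\<^esub>"] exI[of _ "\<zero>\<^bsub>K\<^esub>"])
      show "x \<oplus>\<^bsub>V\<^esub> y \<in> W" if "x \<in> W" "y \<in> W" for x y
      proof -
        obtain u c u' c' where *: "u \<in> U" "c \<in> carrier K" "u' \<in> U" "c' \<in> carrier K"
          "x = u \<oplus>\<^bsub>V\<^esub> c \<odot>\<^bsub>V\<^esub> v" "y = u' \<oplus>\<^bsub>V\<^esub> c' \<odot>\<^bsub>V\<^esub> v"
          using \<open>x \<in> W\<close> \<open>y \<in> W\<close> by (auto simp: W_def)
        then have "x \<oplus>\<^bsub>V\<^esub> y = (u \<oplus>\<^bsub>V\<^esub> u') \<oplus>\<^bsub>V\<^esub> (c \<oplus>\<^bsub>K\<^esub> c') \<odot>\<^bsub>V\<^esub> v"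
          using carr v by (simp add: smult_l_distr M.a_ac)
        then show ?thesis unfolding W_def using * UD(3) by blast
      qed
      show "d \<odot>\<^bsub>V\<^esub> x \<in> W" if "d \<in> carrier K" "x \<in> W" for d x
      proof -
        obtain u c where *: "u \<in> U" "c \<in> carrier K" "x = u \<oplus>\<^bsub>V\<^esub> c \<odot>\<^bsub>V\<^esub> v"
          using \<open>x \<in> W\<close> by (auto simp: W_def)
        then have "d \<odot>\<^bsub>V\<^esub> x = (d \<odot>\<^bsub>V\<^esub> u) \<oplus>\<^bsub>V\<^esub> (d \<otimes>\<^bsub>K\<^esub> c) \<odot>\<^bsub>V\<^esub> v"
          using carr v that by (simp add: smult_r_distr smult_assoc1)
        then show ?thesis unfolding W_def using * UD(4) that by blast
      qed
    qed
    moreover have "U \<subseteq> W"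
    proof
      fix u assume "u \<in> U"
      then have "u = u \<oplus>\<^bsub>V\<^esub> \<zero>\<^bsub>K\<^esub> \<odot>\<^bsub>V\<^esub> v" using carr v by auto
      then show "u \<in> W" unfolding W_def using \<open>u \<in> U\<close> by blast
    qed
    moreover have "v \<in> W"
    proof -
      have "v = \<zero>\<^bsub>V\<^esub> \<oplus>\<^bsub>V\<^esub> \<one>\<^bsub>K\<^esub> \<odot>\<^bsub>V\<^esub> v" using v by auto
      then show ?thesis unfolding W_def using UD(2) by blast
    qed
    ultimately have "t \<in> W" using U_max[of W] U False by (auto simp: \<A>_def)
    then obtain u c where *: "u \<in> U" "c \<in> carrier K" "t = u \<oplus>\<^bsub>V\<^esub> c \<odot>\<^bsub>V\<^esub> v"
      by (auto simp: W_def)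
    have "c \<noteq> \<zero>\<^bsub>K\<^esub>" using * U carr v by auto
    have "c \<odot>\<^bsub>V\<^esub> v = \<ominus>\<^bsub>V\<^esub> u \<oplus>\<^bsub>V\<^esub> t" using * carr v by (simp add: M.r_neg1)
    then have "v = inv\<^bsub>K\<^esub> c \<odot>\<^bsub>V\<^esub> (\<ominus>\<^bsub>V\<^esub> u \<oplus>\<^bsub>V\<^esub> t)"
      using *(2) \<open>c \<noteq> \<zero>\<^bsub>K\<^esub>\<close> v by (intro inv_smult)
    also have "\<dots> = inv\<^bsub>K\<^esub> c \<odot>\<^bsub>V\<^esub> (\<ominus>\<^bsub>V\<^esub> u) \<oplus>\<^bsub>V\<^esub> inv\<^bsub>K\<^esub> c \<odot>\<^bsub>V\<^esub> t"
      using * \<open>c \<noteq> \<zero>\<^bsub>K\<^esub>\<close> carr t by (intro smult_r_distr) auto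
    finally have "v = inv\<^bsub>K\<^esub> c \<odot>\<^bsub>V\<^esub> (\<ominus>\<^bsub>V\<^esub> u) \<oplus>\<^bsub>V\<^esub> inv\<^bsub>K\<^esub> c \<odot>\<^bsub>V\<^esub> t" .
    moreover have "inv\<^bsub>K\<^esub> c \<in> carrier K" using * \<open>c \<noteq> \<zero>\<^bsub>K\<^esub>\<close> by simp
    moreover have "inv\<^bsub>K\<^esub> c \<odot>\<^bsub>V\<^esub> (\<ominus>\<^bsub>V\<^esub> u) \<in> U" using * calculation(2) UD(4,5) by blast
    ultimately show ?thesis unfolding Q_def by blast
  qed
  have Q_unique: "c = d" if Q: "Q v c" "Q v d" for v c d
  proof -
    obtain u w where *: "c \<in> carrier K" "d \<in> carrier K" "u \<in> U" "w \<in> U"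
      "u \<oplus>\<^bsub>V\<^esub> c \<odot>\<^bsub>V\<^esub> t = w \<oplus>\<^bsub>V\<^esub> d \<odot>\<^bsub>V\<^esub> t"
      using Q unfolding Q_def by metis
    have "(c \<oplus>\<^bsub>K\<^esub> \<ominus>\<^bsub>K\<^esub> d) \<odot>\<^bsub>V\<^esub> t
        = \<ominus>\<^bsub>V\<^esub> u \<oplus>\<^bsub>V\<^esub> (u \<oplus>\<^bsub>V\<^esub> c \<odot>\<^bsub>V\<^esub> t) \<oplus>\<^bsub>V\<^esub> \<ominus>\<^bsub>V\<^esub> (d \<odot>\<^bsub>V\<^esub> t)"
      using *(1-4) carr t by (simp add: smult_l_distr smult_l_minus M.r_neg1)
    also have "\<dots> = \<ominus>\<^bsub>V\<^esub> u \<oplus>\<^bsub>V\<^esub> w"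
      unfolding *(5) using *(1-4) carr t by (simp add: M.a_assoc M.r_neg)
    finally have "(c \<oplus>\<^bsub>K\<^esub> \<ominus>\<^bsub>K\<^esub> d) \<odot>\<^bsub>V\<^esub> t \<in> U" using UD(3,5) * by simp
    then have "c \<oplus>\<^bsub>K\<^esub> \<ominus>\<^bsub>K\<^esub> d = \<zero>\<^bsub>K\<^esub>" using zero * by simp
    then show ?thesis using * R.minus_other_side by (simp add: a_minus_def)
  qed
  define f where "f v = (THE c. Q v c)" for v
  have f_eq: "f v = c" if "Q v c" for v c
    unfolding f_def using that Q_unique by blast
  have Q_f: "Q v (f v)" if "v \<in> carrier V" for v
    using Q_ex[OF that] f_eq by auto
  show thesis
  proof (rule that[of f])
    show "f \<in> carrier V \<rightarrow> carrier K" using Q_f by (auto simp: Q_def)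
    show "f (v \<oplus>\<^bsub>V\<^esub> w) = f v \<oplus>\<^bsub>K\<^esub> f w" if vw: "v \<in> carrier V" "w \<in> carrier V" for v w
    proof (rule f_eq)
      obtain u u' where *: "f v \<in> carrier K" "f w \<in> carrier K" "u \<in> U" "u' \<in> U"
        "v = u \<oplus>\<^bsub>V\<^esub> f v \<odot>\<^bsub>V\<^esub> t" "w = u' \<oplus>\<^bsub>V\<^esub> f w \<odot>\<^bsub>V\<^esub> t"
        using vw Q_f unfolding Q_def by meson
      have "v \<oplus>\<^bsub>V\<^esub> w = (u \<oplus>\<^bsub>V\<^esub> f v \<odot>\<^bsub>V\<^esub> t) \<oplus>\<^bsub>V\<^esub> (u' \<oplus>\<^bsub>V\<^esub> f w \<odot>\<^bsub>V\<^esub> t)"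
        by (rule arg_cong2[OF *(5,6)])
      also have "\<dots> = (u \<oplus>\<^bsub>V\<^esub> u') \<oplus>\<^bsub>V\<^esub> (f v \<oplus>\<^bsub>K\<^esub> f w) \<odot>\<^bsub>V\<^esub> t"
        using *(1-4) carr t by (simp add: smult_l_distr M.a_ac)
      finally show "Q (v \<oplus>\<^bsub>V\<^esub> w) (f v \<oplus>\<^bsub>K\<^esub> f w)"
        unfolding Q_def using *(1-4) UD(3) by blast
    qed
    show "f (c \<odot>\<^bsub>V\<^esub> v) = c \<otimes>\<^bsub>K\<^esub> f v" if cv: "c \<in> carrier K" "v \<in> carrier V" for c v
    proof (rule f_eq)
      obtain u where *: "f v \<in> carrier K" "u \<in> U" "v = u \<oplus>\<^bsub>V\<^esub> f v \<odot>\<^bsub>V\<^esub> t"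
        using cv Q_f unfolding Q_def by meson
      have "c \<odot>\<^bsub>V\<^esub> v = c \<odot>\<^bsub>V\<^esub> (u \<oplus>\<^bsub>V\<^esub> f v \<odot>\<^bsub>V\<^esub> t)"
        by (rule arg_cong[OF *(3)])
      also have "\<dots> = (c \<odot>\<^bsub>V\<^esub> u) \<oplus>\<^bsub>V\<^esub> (c \<otimes>\<^bsub>K\<^esub> f v) \<odot>\<^bsub>V\<^esub> t"
        using *(1,2) carr cv t by (simp add: smult_r_distr smult_assoc1)
      finally show "Q (c \<odot>\<^bsub>V\<^esub> v) (c \<otimes>\<^bsub>K\<^esub> f v)"
        unfolding Q_def using *(1,2) cv UD(4) by blast
    qed
    show "f v = \<zero>\<^bsub>K\<^esub>" if "v \<in> D" for v
    proof (rule f_eq)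
      show "Q v \<zero>\<^bsub>K\<^esub>" using that U by (intro Q_zero) auto
    qed
    show "f t = \<one>\<^bsub>K\<^esub>"
    proof (rule f_eq)
      show "Q t \<one>\<^bsub>K\<^esub>" unfolding Q_def using UD(2) t by (auto intro!: bexI[of _ "\<zero>\<^bsub>V\<^esub>"])
    qed
  qed
qed

end

section \<open>Lie algebras\<close>

lemma lie_hom_bracket:
  "\<lbrakk>h \<in> lie_hom F K L; x \<in> carrier K; y \<in> carrier K\<rbrakk> \<Longrightarrow> h \<lbrakk>x, y\<rbrakk>\<^bsub>K\<^esub> = \<lbrakk>h x, h y\<rbrakk>\<^bsub>L\<^esub>"
  by (simp add: lie_hom_def)

lemma lie_hom_linear_map:
  assumes "lie_algebra F K" "lie_algebra F L" "h \<in> lie_hom F K L"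
  shows "linear_map F K L h"
  using assms unfolding lie_hom_def
  by (auto intro!: linear_map.intro mod_hom.intro mod_hom_axioms.intro
      simp: lie_algebra_def vectorspace_def)

lemma lie_hom_comp:
  assumes "g \<in> lie_hom F J K" "h \<in> lie_hom F K L"
  shows "h \<circ> g \<in> lie_hom F J L"
  using assms unfolding lie_hom_def module_hom_def by (auto simp: Pi_def)

context lie_algebra
begin

lemma bracket_zero_left [simp]:
  assumes "y \<in> carrier L"
  shows "\<lbrakk>\<zero>\<^bsub>L\<^esub>, y\<rbrakk>\<^bsub>L\<^esub> = \<zero>\<^bsub>L\<^esub>"
  using bracket_smult_left[of "\<zero>\<^bsub>F\<^esub>" "\<zero>\<^bsub>L\<^esub>" y] assms by (simp add: bracket_closed)

lemma bracket_zero_right [simp]: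
  assumes "x \<in> carrier L"
  shows "\<lbrakk>x, \<zero>\<^bsub>L\<^esub>\<rbrakk>\<^bsub>L\<^esub> = \<zero>\<^bsub>L\<^esub>"
  using bracket_smult_right[of "\<zero>\<^bsub>F\<^esub>" x "\<zero>\<^bsub>L\<^esub>"] assms by (simp add: bracket_closed)

lemma bracket_neg_left:
  assumes "x \<in> carrier L" "y \<in> carrier L"
  shows "\<lbrakk>\<ominus>\<^bsub>L\<^esub> x, y\<rbrakk>\<^bsub>L\<^esub> = \<ominus>\<^bsub>L\<^esub> \<lbrakk>x, y\<rbrakk>\<^bsub>L\<^esub>"
  using bracket_smult_left[of "\<ominus>\<^bsub>F\<^esub> \<one>\<^bsub>F\<^esub>" x y] assms by (simp add: bracket_closed smult_minus_1)

lemma bracket_neg_right: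
  assumes "x \<in> carrier L" "y \<in> carrier L"
  shows "\<lbrakk>x, \<ominus>\<^bsub>L\<^esub> y\<rbrakk>\<^bsub>L\<^esub> = \<ominus>\<^bsub>L\<^esub> \<lbrakk>x, y\<rbrakk>\<^bsub>L\<^esub>"
  using bracket_smult_right[of "\<ominus>\<^bsub>F\<^esub> \<one>\<^bsub>F\<^esub>" x y] assms by (simp add: bracket_closed smult_minus_1)

lemma bracket_antisym:
  assumes "x \<in> carrier L" "y \<in> carrier L"
  shows "\<lbrakk>x, y\<rbrakk>\<^bsub>L\<^esub> = \<ominus>\<^bsub>L\<^esub> \<lbrakk>y, x\<rbrakk>\<^bsub>L\<^esub>"
proof -
  have "\<lbrakk>x, y\<rbrakk>\<^bsub>L\<^esub> \<oplus>\<^bsub>L\<^esub> \<lbrakk>y, x\<rbrakk>\<^bsub>L\<^esub>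
      = (\<lbrakk>x, x\<rbrakk>\<^bsub>L\<^esub> \<oplus>\<^bsub>L\<^esub> \<lbrakk>y, x\<rbrakk>\<^bsub>L\<^esub>) \<oplus>\<^bsub>L\<^esub> (\<lbrakk>x, y\<rbrakk>\<^bsub>L\<^esub> \<oplus>\<^bsub>L\<^esub> \<lbrakk>y, y\<rbrakk>\<^bsub>L\<^esub>)"
    using assms by (simp add: bracket_self bracket_closed M.a_comm)
  also have "\<dots> = \<lbrakk>x \<oplus>\<^bsub>L\<^esub> y, x \<oplus>\<^bsub>L\<^esub> y\<rbrakk>\<^bsub>L\<^esub>"
    using assms by (simp only: bracket_add_left bracket_add_right bracket_closed M.a_closed)
  also have "\<dots> = \<zero>\<^bsub>L\<^esub>"
    using assms by (intro bracket_self) auto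
  finally show ?thesis
    using assms by (intro M.minus_equality[symmetric]) (auto simp: bracket_closed)
qed

lemma brackets_subset: "{\<lbrakk>x, y\<rbrakk>\<^bsub>L\<^esub> | x y. x \<in> carrier L \<and> y \<in> carrier L} \<subseteq> carrier L"
  by (auto simp: bracket_closed)

lemma carrier_derived:
  "carrier (lie_derived F L) = span {\<lbrakk>x, y\<rbrakk>\<^bsub>L\<^esub> | x y. x \<in> carrier L \<and> y \<in> carrier L}"
  by (simp add: lie_derived_def)

lemma subspace_derived: "subspace F (carrier (lie_derived F L)) L"
  unfolding carrier_derived by (rule span_is_subspace[OF brackets_subset])

lemma bracket_in_derived:
  assumes "x \<in> carrier L" "y \<in> carrier L"
  shows "\<lbrakk>x, y\<rbrakk>\<^bsub>L\<^esub> \<in> carrier (lie_derived F L)"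
  unfolding carrier_derived using assms by (intro subsetD[OF in_own_span[OF brackets_subset]]) auto

lemma lie_subalgebra:
  assumes N: "subspace F N L" and closed: "\<And>x y. x \<in> N \<Longrightarrow> y \<in> N \<Longrightarrow> \<lbrakk>x, y\<rbrakk>\<^bsub>L\<^esub> \<in> N"
  shows "lie_algebra F (L\<lparr>carrier := N\<rparr>)"
proof -
  have sub: "x \<in> carrier L" if "x \<in> N" for x using subspaceD(1)[OF N] that by auto
  show ?thesis
    using subspace_is_vs[OF N] closed sub
    by (intro lie_algebra.intro lie_algebra_axioms.intro)
      (auto simp: bracket_add_left bracket_add_right bracket_smult_left bracket_smult_right
        bracket_self jacobi)
qed

end

lemma lie_hom_derived:
  assumes "lie_algebra F K" "lie_algebra F L" "h \<in> lie_hom F K L"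
    and v: "v \<in> carrier (lie_derived F K)"
  shows "h v \<in> carrier (lie_derived F L)"
proof -
  interpret K: lie_algebra F K by fact
  interpret L: lie_algebra F L by fact
  interpret h: linear_map F K L h by (rule lie_hom_linear_map) fact+
  note LD = L.subspaceD[OF L.subspace_derived]
  show ?thesis
    by (rule K.span_induct[OF v[unfolded K.carrier_derived] K.brackets_subset])
      (auto simp: LD lie_hom_bracket[OF assms(3)] L.bracket_in_derived)
qed

subsection \<open>Transport of structure\<close>

text \<open>The operations are computed in \<open>E\<close> and pushed forward, so a bare injection
  of sets becomes an isomorphism onto its image. Hence coordinates chosen without any linearity are
  good enough.\<close>

definition lie_transport :: "('a \<Rightarrow> 'b) \<Rightarrow> ('f, 'a) lie_algebra \<Rightarrow> ('f, 'b) lie_algebra"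
  where "lie_transport g E =
    \<lparr>carrier = g ` carrier E, mult = undefined, one = undefined, zero = g \<zero>\<^bsub>E\<^esub>,
     add = (\<lambda>x y. g (inv_into (carrier E) g x \<oplus>\<^bsub>E\<^esub> inv_into (carrier E) g y)),
     smult = (\<lambda>c x. g (c \<odot>\<^bsub>E\<^esub> inv_into (carrier E) g x)),
     bracket = (\<lambda>x y. g \<lbrakk>inv_into (carrier E) g x, inv_into (carrier E) g y\<rbrakk>\<^bsub>E\<^esub>)\<rparr>"

lemma lie_transport_simps:
  assumes "inj_on g (carrier E)"
  shows "carrier (lie_transport g E) = g ` carrier E"
    and "\<zero>\<^bsub>lie_transport g E\<^esub> = g \<zero>\<^bsub>E\<^esub>"
    and "\<lbrakk>x \<in> carrier E; y \<in> carrier E\<rbrakk> \<Longrightarrow> g x \<oplus>\<^bsub>lie_transport g E\<^esub> g y = g (x \<oplus>\<^bsub>E\<^esub> y)"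
    and "x \<in> carrier E \<Longrightarrow> c \<odot>\<^bsub>lie_transport g E\<^esub> g x = g (c \<odot>\<^bsub>E\<^esub> x)"
    and "\<lbrakk>x \<in> carrier E; y \<in> carrier E\<rbrakk> \<Longrightarrow> \<lbrakk>g x, g y\<rbrakk>\<^bsub>lie_transport g E\<^esub> = g \<lbrakk>x, y\<rbrakk>\<^bsub>E\<^esub>"
  using inv_into_f_f[OF assms] by (auto simp: lie_transport_def)

lemma lie_algebra_transport:
  assumes E: "lie_algebra F E" and g: "inj_on g (carrier E)"
  shows "lie_algebra F (lie_transport g E)"
proof -
  interpret lie_algebra F E by fact
  note [simp] = lie_transport_simps[OF g] bracket_closed
  have "vectorspace F (lie_transport g E)"
  proof (rule vs_criteria)
    show "\<forall>v\<in>carrier (lie_transport g E). \<exists>w\<in>carrier (lie_transport g E).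
        v \<oplus>\<^bsub>lie_transport g E\<^esub> w = \<zero>\<^bsub>lie_transport g E\<^esub>"
    proof
      fix v assume "v \<in> carrier (lie_transport g E)"
      then obtain x where x: "x \<in> carrier E" "v = g x" by auto
      then have "v \<oplus>\<^bsub>lie_transport g E\<^esub> g (\<ominus>\<^bsub>E\<^esub> x) = \<zero>\<^bsub>lie_transport g E\<^esub>"
        by (simp add: M.r_neg)
      then show "\<exists>w\<in>carrier (lie_transport g E).
          v \<oplus>\<^bsub>lie_transport g E\<^esub> w = \<zero>\<^bsub>lie_transport g E\<^esub>" using x by auto
    qed
  qed (auto simp: M.a_ac smult_l_distr smult_r_distr smult_assoc1 intro: field_axioms)
  then show ?thesis
    by (intro lie_algebra.intro lie_algebra_axioms.intro)
      (auto simp: bracket_add_left bracket_add_right bracket_smult_left bracket_smult_right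
        bracket_self jacobi)
qed

lemma lie_hom_transport:
  assumes E: "lie_algebra F E" and g: "inj_on g (carrier E)"
  shows "g \<in> lie_hom F E (lie_transport g E)"
    and "inv_into (carrier E) g \<in> lie_hom F (lie_transport g E) E"
proof -
  interpret lie_algebra F E by fact
  show "g \<in> lie_hom F E (lie_transport g E)"
    "inv_into (carrier E) g \<in> lie_hom F (lie_transport g E) E"
    unfolding lie_hom_def module_hom_def
    by (auto simp: lie_transport_simps[OF g] inv_into_f_f[OF g] bracket_closed)
qed

text \<open>The competitor \<open>E\<close> may live in any type, as coordinates inject its carrier into \<open>nat \<Rightarrow> 'f\<close>.\<close>

lemma lie_cover_dim_max:
  fixes E :: "('f, 'e) lie_algebra"
  assumes L: "lie_algebra F L" and cover: "lie_cover F L K"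
    and E: "lie_algebra F E" "vectorspace.fin_dim F E"
    and p: "p \<in> lie_hom F E L" "p ` carrier E = carrier L"
    and ker: "{x \<in> carrier E. p x = \<zero>\<^bsub>L\<^esub>} \<subseteq> lie_center E \<inter> carrier (lie_derived F E)"
  shows "vectorspace.dim F E \<le> vectorspace.dim F K"
proof -
  interpret L: lie_algebra F L by fact
  interpret E: lie_algebra F E by fact
  obtain g :: "'e \<Rightarrow> nat \<Rightarrow> 'f" where g: "inj_on g (carrier E)"
    using E.fin_dim_inj_coordinates[OF E(2)] .
  define E' where "E' = lie_transport g E"
  define h where "h = inv_into (carrier E) g"
  note hom = lie_hom_transport[OF E(1) g, folded E'_def h_def]
  have E': "lie_algebra F E'" unfolding E'_def by (rule lie_algebra_transport[OF E(1) g])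
  interpret E': lie_algebra F E' by fact
  interpret g: linear_map F E E' g by (rule lie_hom_linear_map[OF E(1) E' hom(1)])
  have carr: "carrier E' = g ` carrier E" by (simp add: E'_def lie_transport_simps(1)[OF g])
  have hg: "h (g x) = x" if "x \<in> carrier E" for x
    unfolding h_def using g that by simp
  have p': "p \<circ> h \<in> lie_hom F E' L" by (rule lie_hom_comp[OF hom(2) p(1)])
  interpret p': linear_map F E' L "p \<circ> h" by (rule lie_hom_linear_map[OF E' L p'])
  \<comment> \<open>The kernel itself, embedded by the identity, serves as the second component of
    the pair, so both components have the type that \<open>lie_cover\<close> quantifies
    over.\<close>
  define N where "N = {x \<in> carrier E'. (p \<circ> h) x = \<zero>\<^bsub>L\<^esub>}"
  have "subspace F N E'"
    using p'.kerT_is_subspace by (simp add: N_def p'.ker_def)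
  moreover have "\<lbrakk>x, y\<rbrakk>\<^bsub>E'\<^esub> \<in> N" if "x \<in> N" "y \<in> N" for x y
    using that lie_hom_bracket[OF p', of x y] by (auto simp: N_def E'.bracket_closed)
  ultimately have M': "lie_algebra F (E'\<lparr>carrier := N\<rparr>)" by (rule E'.lie_subalgebra)
  have "defining_pair F L E' (E'\<lparr>carrier := N\<rparr>)"
    unfolding defining_pair_def
  proof (intro conjI exI)
    show "(\<lambda>x. x) \<in> lie_hom F (E'\<lparr>carrier := N\<rparr>) E'"
      by (auto simp: lie_hom_def module_hom_def N_def)
    show "p \<circ> h \<in> lie_hom F E' L" by fact
    show "(p \<circ> h) ` carrier E' = carrier L"
      using p(2) by (auto simp: carr hg image_image)
    show "(\<lambda>x. x) ` carrier (E'\<lparr>carrier := N\<rparr>) = {x \<in> carrier E'. (p \<circ> h) x = \<zero>\<^bsub>L\<^esub>}"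
      by (simp add: N_def)
    show "(\<lambda>x. x) ` carrier (E'\<lparr>carrier := N\<rparr>) \<subseteq> lie_center E' \<inter> carrier (lie_derived F E')"
    proof
      fix y assume "y \<in> (\<lambda>x. x) ` carrier (E'\<lparr>carrier := N\<rparr>)"
      then obtain x where x: "x \<in> carrier E" "y = g x" "p x = \<zero>\<^bsub>L\<^esub>"
        by (auto simp: N_def carr hg)
      then have c: "x \<in> lie_center E" and "x \<in> carrier (lie_derived F E)" using ker by auto
      then have "y \<in> carrier (lie_derived F E')"
        using lie_hom_derived[OF E(1) E' hom(1)] x by auto
      moreover have "\<lbrakk>g x, g z\<rbrakk>\<^bsub>E'\<^esub> = \<zero>\<^bsub>E'\<^esub>" if "z \<in> carrier E" for z
        using c that x lie_hom_bracket[OF hom(1), of x z] by (auto simp: lie_center_def)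
      ultimately show "y \<in> lie_center E' \<inter> carrier (lie_derived F E')"
        using x by (auto simp: lie_center_def carr)
    qed
  qed (use E' M' in auto)
  then have "vectorspace.dim F E' \<le> vectorspace.dim F K"
    using cover by (auto simp: lie_cover_def)
  moreover have "vectorspace.dim F E = vectorspace.dim F E'"
    by (rule g.dim_eq[OF E(2) g carr[symmetric]])
  ultimately show ?thesis by simp
qed

subsection \<open>Central extensions by the ground field\<close>

text \<open>The standard central extension of \<open>K\<close> by a one-dimensional abelian algebra
  with 2-cocycle \<open>f\<close>. The bracket ignores the scalar parts, which makes the scalars
  central once \<open>f\<close> is bilinear.\<close>

definition scalar_extension ::
  "('f, 'r) ring_scheme \<Rightarrow> ('f, 'a) lie_algebra \<Rightarrow> ('a \<Rightarrow> 'a \<Rightarrow> 'f) \<Rightarrow> ('f, 'a \<times> 'f) lie_algebra"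
  where "scalar_extension F K f =
    \<lparr>carrier = carrier K \<times> carrier F, mult = undefined, one = undefined,
     zero = (\<zero>\<^bsub>K\<^esub>, \<zero>\<^bsub>F\<^esub>),
     add = (\<lambda>(x, a) (y, b). (x \<oplus>\<^bsub>K\<^esub> y, a \<oplus>\<^bsub>F\<^esub> b)),
     smult = (\<lambda>c (x, a). (c \<odot>\<^bsub>K\<^esub> x, c \<otimes>\<^bsub>F\<^esub> a)),
     bracket = (\<lambda>(x, a) (y, b). (\<lbrakk>x, y\<rbrakk>\<^bsub>K\<^esub>, f x y))\<rparr>"

lemma scalar_extension_simps [simp]:
  "carrier (scalar_extension F K f) = carrier K \<times> carrier F"
  "\<zero>\<^bsub>scalar_extension F K f\<^esub> = (\<zero>\<^bsub>K\<^esub>, \<zero>\<^bsub>F\<^esub>)"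
  "(x, a) \<oplus>\<^bsub>scalar_extension F K f\<^esub> (y, b) = (x \<oplus>\<^bsub>K\<^esub> y, a \<oplus>\<^bsub>F\<^esub> b)"
  "c \<odot>\<^bsub>scalar_extension F K f\<^esub> (x, a) = (c \<odot>\<^bsub>K\<^esub> x, c \<otimes>\<^bsub>F\<^esub> a)"
  "\<lbrakk>(x, a), (y, b)\<rbrakk>\<^bsub>scalar_extension F K f\<^esub> = (\<lbrakk>x, y\<rbrakk>\<^bsub>K\<^esub>, f x y)"
  by (simp_all add: scalar_extension_def)

text \<open>These conditions make \<open>scalar_extension\<close> a Lie algebra. Alternation rather
  than skew symmetry matters in characteristic 2, where only the former yields
  \<open>bracket_self\<close>; the cyclic identity is the scalar component of the Jacobi
  identity.\<close>

locale lie_cocycle = lie_algebra F K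
  for F :: "('f, 'r) ring_scheme" and K :: "('f, 'a) lie_algebra" +
  fixes f :: "'a \<Rightarrow> 'a \<Rightarrow> 'f"
  assumes cocycle_closed:
      "\<lbrakk>x \<in> carrier K; y \<in> carrier K\<rbrakk> \<Longrightarrow> f x y \<in> carrier F"
    and cocycle_add_left:
      "\<lbrakk>x \<in> carrier K; y \<in> carrier K; z \<in> carrier K\<rbrakk> \<Longrightarrow> f (x \<oplus>\<^bsub>K\<^esub> y) z = f x z \<oplus>\<^bsub>F\<^esub> f y z"
    and cocycle_add_right:
      "\<lbrakk>x \<in> carrier K; y \<in> carrier K; z \<in> carrier K\<rbrakk> \<Longrightarrow> f x (y \<oplus>\<^bsub>K\<^esub> z) = f x y \<oplus>\<^bsub>F\<^esub> f x z"
    and cocycle_smult_left: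
      "\<lbrakk>c \<in> carrier F; x \<in> carrier K; y \<in> carrier K\<rbrakk> \<Longrightarrow> f (c \<odot>\<^bsub>K\<^esub> x) y = c \<otimes>\<^bsub>F\<^esub> f x y"
    and cocycle_smult_right:
      "\<lbrakk>c \<in> carrier F; x \<in> carrier K; y \<in> carrier K\<rbrakk> \<Longrightarrow> f x (c \<odot>\<^bsub>K\<^esub> y) = c \<otimes>\<^bsub>F\<^esub> f x y"
    and cocycle_self: "x \<in> carrier K \<Longrightarrow> f x x = \<zero>\<^bsub>F\<^esub>"
    and cocycle_jacobi:
      "\<lbrakk>x \<in> carrier K; y \<in> carrier K; z \<in> carrier K\<rbrakk> \<Longrightarrow>
        f x \<lbrakk>y, z\<rbrakk>\<^bsub>K\<^esub> \<oplus>\<^bsub>F\<^esub> f y \<lbrakk>z, x\<rbrakk>\<^bsub>K\<^esub> \<oplus>\<^bsub>F\<^esub> f z \<lbrakk>x, y\<rbrakk>\<^bsub>K\<^esub> = \<zero>\<^bsub>F\<^esub>"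
begin

abbreviation "E \<equiv> scalar_extension F K f"

lemma vectorspace_extension: "vectorspace F E"
proof (rule vs_criteria)
  show "\<forall>v\<in>carrier E. \<exists>w\<in>carrier E. v \<oplus>\<^bsub>E\<^esub> w = \<zero>\<^bsub>E\<^esub>"
  proof
    fix v assume "v \<in> carrier E"
    then obtain x a where "x \<in> carrier K" "a \<in> carrier F" "v = (x, a)" by auto
    then have "(\<ominus>\<^bsub>K\<^esub> x, \<ominus>\<^bsub>F\<^esub> a) \<in> carrier E" "v \<oplus>\<^bsub>E\<^esub> (\<ominus>\<^bsub>K\<^esub> x, \<ominus>\<^bsub>F\<^esub> a) = \<zero>\<^bsub>E\<^esub>"
      by (auto simp: M.r_neg R.r_neg)
    then show "\<exists>w\<in>carrier E. v \<oplus>\<^bsub>E\<^esub> w = \<zero>\<^bsub>E\<^esub>" by blast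
  qed
qed (auto simp: M.a_ac R.a_ac smult_l_distr smult_r_distr smult_assoc1 R.l_distr R.r_distr R.m_assoc
    intro: field_axioms)

lemma lie_algebra_extension: "lie_algebra F E"
  using vectorspace_extension
  by (intro lie_algebra.intro lie_algebra_axioms.intro)
    (auto simp: bracket_closed bracket_add_left bracket_add_right bracket_smult_left
      bracket_smult_right bracket_self jacobi cocycle_closed cocycle_add_left cocycle_add_right
      cocycle_smult_left cocycle_smult_right cocycle_self cocycle_jacobi)

lemma fst_lie_hom: "fst \<in> lie_hom F E K"
  by (auto simp: lie_hom_def module_hom_def)

text \<open>The projection \<open>fst\<close> is onto \<open>K\<close> and its kernel is the line of
  scalars, so rank-nullity adds exactly one. That theorem presupposes finite dimension of the
  extension, which is therefore settled first.\<close>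

lemma extension_dim:
  assumes fin_dim
  shows "vectorspace.fin_dim F E" and "vectorspace.dim F E = dim + 1"
proof -
  interpret E: lie_algebra F E by (rule lie_algebra_extension)
  interpret p: linear_map F E K fst
    by (rule lie_hom_linear_map[OF lie_algebra_extension lie_algebra_axioms fst_lie_hom])
  obtain A where A: "finite A" "A \<subseteq> carrier K" "span A = carrier K"
    using assms unfolding fin_dim_def by auto
  \<comment> \<open>A spanning set of \<open>K\<close> in the first coordinate, and one vector for
    the new scalar direction.\<close>
  define S where "S = insert (\<zero>\<^bsub>K\<^esub>, \<one>\<^bsub>F\<^esub>) ((\<lambda>x. (x, \<zero>\<^bsub>F\<^esub>)) ` A)"
  have S: "finite S" "S \<subseteq> carrier E" using A by (auto simp: S_def)
  note SD = E.subspaceD[OF E.span_is_subspace[OF S(2)]]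
  note S_span = subsetD[OF E.in_own_span[OF S(2)]]
  have "(x, \<zero>\<^bsub>F\<^esub>) \<in> E.span S" if "x \<in> span A" for x
  proof (rule span_induct[OF that A(2)])
    show "(\<zero>\<^bsub>K\<^esub>, \<zero>\<^bsub>F\<^esub>) \<in> E.span S" using SD(2) by simp
    show "(x, \<zero>\<^bsub>F\<^esub>) \<in> E.span S" if "x \<in> A" for x using that by (intro S_span) (auto simp: S_def)
    show "(x \<oplus>\<^bsub>K\<^esub> y, \<zero>\<^bsub>F\<^esub>) \<in> E.span S" if "(x, \<zero>\<^bsub>F\<^esub>) \<in> E.span S" "(y, \<zero>\<^bsub>F\<^esub>) \<in> E.span S" for x y
      using SD(3)[OF that] by simp
    show "(c \<odot>\<^bsub>K\<^esub> x, \<zero>\<^bsub>F\<^esub>) \<in> E.span S" if "c \<in> carrier F" "(x, \<zero>\<^bsub>F\<^esub>) \<in> E.span S" for c x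
      using SD(4)[OF that] that(1) by simp
  qed
  moreover have "(\<zero>\<^bsub>K\<^esub>, a) \<in> E.span S" if "a \<in> carrier F" for a
    using SD(4)[OF that S_span, of "(\<zero>\<^bsub>K\<^esub>, \<one>\<^bsub>F\<^esub>)"] that by (simp add: S_def)
  ultimately have "(x, a) \<in> E.span S" if "x \<in> carrier K" "a \<in> carrier F" for x a
    using SD(3)[of "(x, \<zero>\<^bsub>F\<^esub>)" "(\<zero>\<^bsub>K\<^esub>, a)"] that A(3) by simp
  then have "E.span S = carrier E" using SD(1) by auto
  then show fin_E: "E.fin_dim" using S unfolding E.fin_dim_def by auto
  have "fst ` carrier E = carrier K" by auto
  then have im: "p.imT = carrier K" by (rule p.surj_imp_imT_carrier)
  have ker: "p.kerT = {\<zero>\<^bsub>K\<^esub>} \<times> carrier F" by (auto simp: p.ker_def)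
  interpret ker: vectorspace F "E.vs p.kerT"
    by (rule E.subspace_is_vs[OF p.kerT_is_subspace])
  have "ker.dim = 1"
  proof (rule ker.dim1I)
    have sub: "{(\<zero>\<^bsub>K\<^esub>, \<one>\<^bsub>F\<^esub>)} \<subseteq> carrier (E.vs p.kerT)" by (simp add: ker)
    show "ker.span {(\<zero>\<^bsub>K\<^esub>, \<one>\<^bsub>F\<^esub>)} = carrier (E.vs p.kerT)"
    proof
      show "ker.span {(\<zero>\<^bsub>K\<^esub>, \<one>\<^bsub>F\<^esub>)} \<subseteq> carrier (E.vs p.kerT)"
        by (rule ker.span_is_subset2[OF sub])
      show "carrier (E.vs p.kerT) \<subseteq> ker.span {(\<zero>\<^bsub>K\<^esub>, \<one>\<^bsub>F\<^esub>)}"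
      proof
        fix v assume "v \<in> carrier (E.vs p.kerT)"
        then obtain a where a: "a \<in> carrier F" "v = (\<zero>\<^bsub>K\<^esub>, a)" by (auto simp: ker)
        have "(\<zero>\<^bsub>K\<^esub>, \<one>\<^bsub>F\<^esub>) \<in> ker.span {(\<zero>\<^bsub>K\<^esub>, \<one>\<^bsub>F\<^esub>)}"
          using ker.in_own_span[OF sub] by simp
        from ker.subspaceD(4)[OF ker.span_is_subspace[OF sub] a(1) this]
        show "v \<in> ker.span {(\<zero>\<^bsub>K\<^esub>, \<one>\<^bsub>F\<^esub>)}" using a by simp
      qed
    qed
    show "(\<zero>\<^bsub>K\<^esub>, \<one>\<^bsub>F\<^esub>) \<noteq> \<zero>\<^bsub>E.vs p.kerT\<^esub>" by simp
    show "(\<zero>\<^bsub>K\<^esub>, \<one>\<^bsub>F\<^esub>) \<in> carrier (E.vs p.kerT)" by (simp add: ker)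
  qed
  moreover have "vectorspace.dim F (vs p.imT) + ker.dim = E.dim"
    by (rule p.rank_nullity[OF fin_E])
  ultimately show "E.dim = dim + 1" by (simp add: im)
qed

end

section \<open>The tensor square\<close>

context lie_algebra
begin

abbreviation "T \<equiv> tensor_square F L"
abbreviation "cls \<equiv> tensor_class F L"
abbreviation "gen l k \<equiv> tensor_class F L (TGen l k)"

section \<open>Congruence classes of formal terms\<close>

lemma tensor_eq_terms:
  assumes "tensor_eq F L s t"
  shows "s \<in> tensor_terms F L \<and> t \<in> tensor_terms F L"
  using assms by induction (auto intro!: tensor_terms.intros simp: bracket_closed)

lemma tensor_class_eq_iff:
  assumes "t \<in> tensor_terms F L"
  shows "cls s = cls t \<longleftrightarrow> tensor_eq F L s t"
proof
  assume "cls s = cls t"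
  then show "tensor_eq F L s t"
    using te_refl[OF assms] by (auto simp: tensor_class_def)
next
  assume "tensor_eq F L s t"
  then show "cls s = cls t"
    unfolding tensor_class_def by (auto intro: te_trans te_sym)
qed

lemma tensor_class_eqI: "tensor_eq F L s t \<Longrightarrow> cls s = cls t"
  using tensor_class_eq_iff tensor_eq_terms by blast

text \<open>The operations are unions over all representatives. The congruence rules make all sets
  in such a union equal, and \<open>te_refl\<close> provides at least one of them, so the union is a
  single class.\<close>

lemma tensor_square_simps:
  shows "carrier T = cls ` tensor_terms F L" "\<zero>\<^bsub>T\<^esub> = cls TZero"
    and "\<lbrakk>s \<in> tensor_terms F L; t \<in> tensor_terms F L\<rbrakk> \<Longrightarrow> cls s \<oplus>\<^bsub>T\<^esub> cls t = cls (TAdd s t)"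
    and "\<lbrakk>c \<in> carrier F; t \<in> tensor_terms F L\<rbrakk> \<Longrightarrow> c \<odot>\<^bsub>T\<^esub> cls t = cls (TScale c t)"
    and "\<lbrakk>s \<in> tensor_terms F L; t \<in> tensor_terms F L\<rbrakk> \<Longrightarrow> \<lbrakk>cls s, cls t\<rbrakk>\<^bsub>T\<^esub> = cls (TBracket s t)"
proof -
  show "carrier T = cls ` tensor_terms F L" "\<zero>\<^bsub>T\<^esub> = cls TZero"
    by (simp_all add: tensor_square_def)
  have self: "t \<in> cls t" if "t \<in> tensor_terms F L" for t
    using te_refl[OF that] by (simp add: tensor_class_def)
  have eq: "tensor_eq F L t s" if "s \<in> cls t" for s t
    using that by (simp add: tensor_class_def)
  show "cls s \<oplus>\<^bsub>T\<^esub> cls t = cls (TAdd s t)" if st: "s \<in> tensor_terms F L" "t \<in> tensor_terms F L" for s t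
  proof -
    have "cls (TAdd a b) = cls (TAdd s t)" if "a \<in> cls s" "b \<in> cls t" for a b
      using eq that by (intro tensor_class_eqI te_cong_add te_sym[of F L s] te_sym[of F L t])
    then have "(\<Union>a\<in>cls s. \<Union>b\<in>cls t. cls (TAdd a b)) = cls (TAdd s t)"
      using self[OF st(1)] self[OF st(2)] by blast
    then show ?thesis by (simp add: tensor_square_def)
  qed
  show "c \<odot>\<^bsub>T\<^esub> cls t = cls (TScale c t)" if ct: "c \<in> carrier F" "t \<in> tensor_terms F L" for c t
  proof -
    have "cls (TScale c b) = cls (TScale c t)" if "b \<in> cls t" for b
      using eq that ct by (intro tensor_class_eqI te_cong_scale te_sym[of F L t])
    then have "(\<Union>b\<in>cls t. cls (TScale c b)) = cls (TScale c t)"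
      using self[OF ct(2)] by blast
    then show ?thesis by (simp add: tensor_square_def)
  qed
  show "\<lbrakk>cls s, cls t\<rbrakk>\<^bsub>T\<^esub> = cls (TBracket s t)" if st: "s \<in> tensor_terms F L" "t \<in> tensor_terms F L" for s t
  proof -
    have "cls (TBracket a b) = cls (TBracket s t)" if "a \<in> cls s" "b \<in> cls t" for a b
      using eq that by (intro tensor_class_eqI te_cong_bracket te_sym[of F L s] te_sym[of F L t])
    then have "(\<Union>a\<in>cls s. \<Union>b\<in>cls t. cls (TBracket a b)) = cls (TBracket s t)"
      using self[OF st(1)] self[OF st(2)] by blast
    then show ?thesis by (simp add: tensor_square_def)
  qed
qed

lemma vectorspace_tensor_square: "vectorspace F T"
proof (rule vs_criteria)
  note [simp] = tensor_square_simps and [intro] = tensor_terms.intros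
  note I = tensor_class_eqI
  show "field F" by (rule field_axioms)
  show "\<zero>\<^bsub>T\<^esub> \<in> carrier T" by auto
  show "\<forall>v w. v \<in> carrier T \<and> w \<in> carrier T \<longrightarrow> v \<oplus>\<^bsub>T\<^esub> w \<in> carrier T" by auto
  show "\<forall>v\<in>carrier T. \<exists>w\<in>carrier T. v \<oplus>\<^bsub>T\<^esub> w = \<zero>\<^bsub>T\<^esub>"
  proof
    fix v assume "v \<in> carrier T"
    then obtain t where t: "t \<in> tensor_terms F L" "v = cls t" by auto
    then have "TNeg t \<in> tensor_terms F L" by auto
    moreover have "cls (TAdd t (TNeg t)) = cls TZero"
      using t by (intro I te_trans[OF te_add_comm te_add_neg]) auto
    ultimately show "\<exists>w\<in>carrier T. v \<oplus>\<^bsub>T\<^esub> w = \<zero>\<^bsub>T\<^esub>"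
      using t by (intro bexI[of _ "cls (TNeg t)"]) auto
  qed
  show "\<forall>c v. c \<in> carrier F \<and> v \<in> carrier T \<longrightarrow> c \<odot>\<^bsub>T\<^esub> v \<in> carrier T" by auto
  show "\<forall>v w. v \<in> carrier T \<and> w \<in> carrier T \<longrightarrow> v \<oplus>\<^bsub>T\<^esub> w = w \<oplus>\<^bsub>T\<^esub> v"
    using I[OF te_add_comm] by auto
  show "\<forall>v w x. v \<in> carrier T \<and> w \<in> carrier T \<and> x \<in> carrier T \<longrightarrow>
      v \<oplus>\<^bsub>T\<^esub> w \<oplus>\<^bsub>T\<^esub> x = v \<oplus>\<^bsub>T\<^esub> (w \<oplus>\<^bsub>T\<^esub> x)"
  proof (intro allI impI)
    fix v w x assume "v \<in> carrier T \<and> w \<in> carrier T \<and> x \<in> carrier T"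
    then obtain s t u where *: "s \<in> tensor_terms F L" "t \<in> tensor_terms F L" "u \<in> tensor_terms F L"
      "v = cls s" "w = cls t" "x = cls u" by auto
    have "TAdd s t \<in> tensor_terms F L" "TAdd t u \<in> tensor_terms F L" using * by auto
    then show "v \<oplus>\<^bsub>T\<^esub> w \<oplus>\<^bsub>T\<^esub> x = v \<oplus>\<^bsub>T\<^esub> (w \<oplus>\<^bsub>T\<^esub> x)"
      using * I[OF te_add_assoc, of s t u] by simp
  qed
  show "\<forall>v\<in>carrier T. v \<oplus>\<^bsub>T\<^esub> \<zero>\<^bsub>T\<^esub> = v"
  proof
    fix v assume "v \<in> carrier T"
    then obtain t where t: "t \<in> tensor_terms F L" "v = cls t" by auto
    moreover have Z: "TZero \<in> tensor_terms F L" by auto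
    ultimately show "v \<oplus>\<^bsub>T\<^esub> \<zero>\<^bsub>T\<^esub> = v"
      using I[OF te_trans[OF te_add_comm te_add_zero], of t] by simp
  qed
  show "\<forall>a b v. a \<in> carrier F \<and> b \<in> carrier F \<and> v \<in> carrier T \<longrightarrow>
      (a \<otimes>\<^bsub>F\<^esub> b) \<odot>\<^bsub>T\<^esub> v = a \<odot>\<^bsub>T\<^esub> (b \<odot>\<^bsub>T\<^esub> v)"
  proof (intro allI impI)
    fix a b v assume "a \<in> carrier F \<and> b \<in> carrier F \<and> v \<in> carrier T"
    then obtain t where *: "a \<in> carrier F" "b \<in> carrier F" "t \<in> tensor_terms F L" "v = cls t" by auto
    have "TScale b t \<in> tensor_terms F L" using * by auto
    then show "(a \<otimes>\<^bsub>F\<^esub> b) \<odot>\<^bsub>T\<^esub> v = a \<odot>\<^bsub>T\<^esub> (b \<odot>\<^bsub>T\<^esub> v)"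
      using * I[OF te_scale_mult, of a b t] by simp
  qed
  show "\<forall>v\<in>carrier T. \<one>\<^bsub>F\<^esub> \<odot>\<^bsub>T\<^esub> v = v"
    using I[OF te_scale_one] by auto
  show "\<forall>a b v. a \<in> carrier F \<and> b \<in> carrier F \<and> v \<in> carrier T \<longrightarrow>
      (a \<oplus>\<^bsub>F\<^esub> b) \<odot>\<^bsub>T\<^esub> v = a \<odot>\<^bsub>T\<^esub> v \<oplus>\<^bsub>T\<^esub> b \<odot>\<^bsub>T\<^esub> v"
  proof (intro allI impI)
    fix a b v assume "a \<in> carrier F \<and> b \<in> carrier F \<and> v \<in> carrier T"
    then obtain t where *: "a \<in> carrier F" "b \<in> carrier F" "t \<in> tensor_terms F L" "v = cls t" by auto
    have "TScale a t \<in> tensor_terms F L" "TScale b t \<in> tensor_terms F L" using * by auto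
    then show "(a \<oplus>\<^bsub>F\<^esub> b) \<odot>\<^bsub>T\<^esub> v = a \<odot>\<^bsub>T\<^esub> v \<oplus>\<^bsub>T\<^esub> b \<odot>\<^bsub>T\<^esub> v"
      using * I[OF te_scale_add_left, of a b t] by simp
  qed
  show "\<forall>a v w. a \<in> carrier F \<and> v \<in> carrier T \<and> w \<in> carrier T \<longrightarrow>
      a \<odot>\<^bsub>T\<^esub> (v \<oplus>\<^bsub>T\<^esub> w) = a \<odot>\<^bsub>T\<^esub> v \<oplus>\<^bsub>T\<^esub> a \<odot>\<^bsub>T\<^esub> w"
  proof (intro allI impI)
    fix a v w assume "a \<in> carrier F \<and> v \<in> carrier T \<and> w \<in> carrier T"
    then obtain s t where *: "a \<in> carrier F" "s \<in> tensor_terms F L" "t \<in> tensor_terms F L"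
      "v = cls s" "w = cls t" by auto
    have "TScale a s \<in> tensor_terms F L" "TScale a t \<in> tensor_terms F L" "TAdd s t \<in> tensor_terms F L"
      using * by auto
    then show "a \<odot>\<^bsub>T\<^esub> (v \<oplus>\<^bsub>T\<^esub> w) = a \<odot>\<^bsub>T\<^esub> v \<oplus>\<^bsub>T\<^esub> a \<odot>\<^bsub>T\<^esub> w"
      using * I[OF te_scale_add_right, of a s t] by simp
  qed
qed

lemma lie_algebra_tensor_square: "lie_algebra F T"
proof (intro lie_algebra.intro lie_algebra_axioms.intro vectorspace_tensor_square)
  note [simp] = tensor_square_simps and [intro] = tensor_terms.intros
  fix x y z assume "x \<in> carrier T" "y \<in> carrier T"
  then obtain s t where st: "s \<in> tensor_terms F L" "t \<in> tensor_terms F L" "x = cls s" "y = cls t"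
    by auto
  then have st': "TBracket s t \<in> tensor_terms F L" "TAdd s t \<in> tensor_terms F L" by auto
  show "\<lbrakk>x, y\<rbrakk>\<^bsub>T\<^esub> \<in> carrier T" using st by auto
  show "\<lbrakk>x, x\<rbrakk>\<^bsub>T\<^esub> = \<zero>\<^bsub>T\<^esub>" using st tensor_class_eqI[OF te_bracket_self, of s] by simp
  show "\<lbrakk>c \<odot>\<^bsub>T\<^esub> x, y\<rbrakk>\<^bsub>T\<^esub> = c \<odot>\<^bsub>T\<^esub> \<lbrakk>x, y\<rbrakk>\<^bsub>T\<^esub>" "\<lbrakk>x, c \<odot>\<^bsub>T\<^esub> y\<rbrakk>\<^bsub>T\<^esub> = c \<odot>\<^bsub>T\<^esub> \<lbrakk>x, y\<rbrakk>\<^bsub>T\<^esub>"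
    if "c \<in> carrier F" for c
  proof -
    have "TScale c s \<in> tensor_terms F L" "TScale c t \<in> tensor_terms F L" using st that by auto
    then show "\<lbrakk>c \<odot>\<^bsub>T\<^esub> x, y\<rbrakk>\<^bsub>T\<^esub> = c \<odot>\<^bsub>T\<^esub> \<lbrakk>x, y\<rbrakk>\<^bsub>T\<^esub>" "\<lbrakk>x, c \<odot>\<^bsub>T\<^esub> y\<rbrakk>\<^bsub>T\<^esub> = c \<odot>\<^bsub>T\<^esub> \<lbrakk>x, y\<rbrakk>\<^bsub>T\<^esub>"
      using st st' that tensor_class_eqI[OF te_bracket_scale_left, of c s t]
        tensor_class_eqI[OF te_bracket_scale_right, of c s t] by simp_all
  qed
  assume "z \<in> carrier T"
  then obtain u where u: "u \<in> tensor_terms F L" "z = cls u" by auto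
  have u': "TAdd t u \<in> tensor_terms F L" "TBracket s u \<in> tensor_terms F L"
    "TBracket t u \<in> tensor_terms F L" "TBracket u s \<in> tensor_terms F L"
    "TBracket s (TBracket t u) \<in> tensor_terms F L" "TBracket t (TBracket u s) \<in> tensor_terms F L"
    "TBracket u (TBracket s t) \<in> tensor_terms F L"
    "TAdd (TBracket s (TBracket t u)) (TBracket t (TBracket u s)) \<in> tensor_terms F L"
    using st u by auto
  show "\<lbrakk>x \<oplus>\<^bsub>T\<^esub> y, z\<rbrakk>\<^bsub>T\<^esub> = \<lbrakk>x, z\<rbrakk>\<^bsub>T\<^esub> \<oplus>\<^bsub>T\<^esub> \<lbrakk>y, z\<rbrakk>\<^bsub>T\<^esub>"
    "\<lbrakk>x, y \<oplus>\<^bsub>T\<^esub> z\<rbrakk>\<^bsub>T\<^esub> = \<lbrakk>x, y\<rbrakk>\<^bsub>T\<^esub> \<oplus>\<^bsub>T\<^esub> \<lbrakk>x, z\<rbrakk>\<^bsub>T\<^esub>"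
    "\<lbrakk>x, \<lbrakk>y, z\<rbrakk>\<^bsub>T\<^esub>\<rbrakk>\<^bsub>T\<^esub> \<oplus>\<^bsub>T\<^esub> \<lbrakk>y, \<lbrakk>z, x\<rbrakk>\<^bsub>T\<^esub>\<rbrakk>\<^bsub>T\<^esub> \<oplus>\<^bsub>T\<^esub> \<lbrakk>z, \<lbrakk>x, y\<rbrakk>\<^bsub>T\<^esub>\<rbrakk>\<^bsub>T\<^esub> = \<zero>\<^bsub>T\<^esub>"
    using st st' u u' tensor_class_eqI[OF te_bracket_add_left, of s t u]
      tensor_class_eqI[OF te_bracket_add_right, of s t u] tensor_class_eqI[OF te_jacobi, of s t u]
    by simp_all
qed

section \<open>Generators and relations of the tensor square\<close>

lemma gen_closed [simp]: "l \<in> carrier L \<Longrightarrow> k \<in> carrier L \<Longrightarrow> gen l k \<in> carrier T"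
  by (auto simp: tensor_square_simps intro: tensor_terms.intros)

text \<open>The record has no field for negation, so the negation symbol of the terms has to be
  matched with the inverse that addition determines.\<close>

lemma tensor_class_neg:
  assumes "t \<in> tensor_terms F L"
  shows "cls (TNeg t) = \<ominus>\<^bsub>T\<^esub> cls t"
proof -
  interpret T: lie_algebra F T by (rule lie_algebra_tensor_square)
  have "cls (TNeg t) \<oplus>\<^bsub>T\<^esub> cls t = \<zero>\<^bsub>T\<^esub>"
    using assms tensor_class_eqI[OF te_add_neg]
    by (simp add: tensor_square_simps tensor_terms.intros)
  then show ?thesis
    using assms by (intro T.M.minus_equality[symmetric]) (auto simp: tensor_square_simps intro: tensor_terms.intros)
qed

lemma gen_relations:
  shows "\<lbrakk>l \<in> carrier L; l' \<in> carrier L; k \<in> carrier L\<rbrakk> \<Longrightarrow> gen (l \<oplus>\<^bsub>L\<^esub> l') k = gen l k \<oplus>\<^bsub>T\<^esub> gen l' k"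
    and "\<lbrakk>l \<in> carrier L; k \<in> carrier L; k' \<in> carrier L\<rbrakk> \<Longrightarrow> gen l (k \<oplus>\<^bsub>L\<^esub> k') = gen l k \<oplus>\<^bsub>T\<^esub> gen l k'"
    and "\<lbrakk>c \<in> carrier F; l \<in> carrier L; k \<in> carrier L\<rbrakk> \<Longrightarrow> gen (c \<odot>\<^bsub>L\<^esub> l) k = c \<odot>\<^bsub>T\<^esub> gen l k"
    and "\<lbrakk>c \<in> carrier F; l \<in> carrier L; k \<in> carrier L\<rbrakk> \<Longrightarrow> gen l (c \<odot>\<^bsub>L\<^esub> k) = c \<odot>\<^bsub>T\<^esub> gen l k"
    and "\<lbrakk>l \<in> carrier L; l' \<in> carrier L; k \<in> carrier L\<rbrakk> \<Longrightarrow>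
      gen \<lbrakk>l, l'\<rbrakk>\<^bsub>L\<^esub> k = gen l \<lbrakk>l', k\<rbrakk>\<^bsub>L\<^esub> \<oplus>\<^bsub>T\<^esub> \<ominus>\<^bsub>T\<^esub> gen l' \<lbrakk>l, k\<rbrakk>\<^bsub>L\<^esub>"
    and "\<lbrakk>l \<in> carrier L; k \<in> carrier L; l' \<in> carrier L; k' \<in> carrier L\<rbrakk> \<Longrightarrow>
      \<lbrakk>gen l k, gen l' k'\<rbrakk>\<^bsub>T\<^esub> = \<ominus>\<^bsub>T\<^esub> gen \<lbrakk>k, l\<rbrakk>\<^bsub>L\<^esub> \<lbrakk>l', k'\<rbrakk>\<^bsub>L\<^esub>"
proof -
  note [simp] = tensor_terms.intros bracket_closed
  show "\<lbrakk>l \<in> carrier L; l' \<in> carrier L; k \<in> carrier L\<rbrakk> \<Longrightarrow> gen (l \<oplus>\<^bsub>L\<^esub> l') k = gen l k \<oplus>\<^bsub>T\<^esub> gen l' k"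
    by (simp add: tensor_square_simps tensor_class_eqI te_gen_add_left)
  show "\<lbrakk>l \<in> carrier L; k \<in> carrier L; k' \<in> carrier L\<rbrakk> \<Longrightarrow> gen l (k \<oplus>\<^bsub>L\<^esub> k') = gen l k \<oplus>\<^bsub>T\<^esub> gen l k'"
    by (simp add: tensor_square_simps tensor_class_eqI te_gen_add_right)
  show "\<lbrakk>c \<in> carrier F; l \<in> carrier L; k \<in> carrier L\<rbrakk> \<Longrightarrow> gen (c \<odot>\<^bsub>L\<^esub> l) k = c \<odot>\<^bsub>T\<^esub> gen l k"
    by (simp add: tensor_square_simps tensor_class_eqI te_smult_left te_sym)
  show "\<lbrakk>c \<in> carrier F; l \<in> carrier L; k \<in> carrier L\<rbrakk> \<Longrightarrow> gen l (c \<odot>\<^bsub>L\<^esub> k) = c \<odot>\<^bsub>T\<^esub> gen l k"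
    by (simp add: tensor_square_simps tensor_class_eqI te_smult_right te_sym)
  show "\<lbrakk>l \<in> carrier L; l' \<in> carrier L; k \<in> carrier L\<rbrakk> \<Longrightarrow>
      gen \<lbrakk>l, l'\<rbrakk>\<^bsub>L\<^esub> k = gen l \<lbrakk>l', k\<rbrakk>\<^bsub>L\<^esub> \<oplus>\<^bsub>T\<^esub> \<ominus>\<^bsub>T\<^esub> gen l' \<lbrakk>l, k\<rbrakk>\<^bsub>L\<^esub>"
    by (simp add: tensor_class_neg[symmetric] tensor_square_simps tensor_class_eqI te_gen_bracket_left)
  show "\<lbrakk>l \<in> carrier L; k \<in> carrier L; l' \<in> carrier L; k' \<in> carrier L\<rbrakk> \<Longrightarrow>
      \<lbrakk>gen l k, gen l' k'\<rbrakk>\<^bsub>T\<^esub> = \<ominus>\<^bsub>T\<^esub> gen \<lbrakk>k, l\<rbrakk>\<^bsub>L\<^esub> \<lbrakk>l', k'\<rbrakk>\<^bsub>L\<^esub>"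
    by (simp add: tensor_class_neg[symmetric] tensor_square_simps tensor_class_eqI te_bracket_gen)
qed

definition tensor_gens :: "('f, 'a) tensor_term set set"
  where "tensor_gens = {gen l k | l k. l \<in> carrier L \<and> k \<in> carrier L}"

lemma tensor_gens_subset: "tensor_gens \<subseteq> carrier T"
  by (auto simp: tensor_gens_def)

text \<open>Relation (iv) makes the bracket redundant: the generators already span as a vector space.\<close>

lemma span_tensor_gens: "LinearCombinations.module.span F T tensor_gens = carrier T"
proof -
  interpret T: lie_algebra F T by (rule lie_algebra_tensor_square)
  note SD = T.subspaceD[OF T.span_is_subspace[OF tensor_gens_subset]]
  note in_span = subsetD[OF T.in_own_span[OF tensor_gens_subset]]
  \<comment> \<open>By (iv) the bracket of two generators is minus a generator. Linearity, first in
    the left argument and then in the right one, extends this closure to the whole span.\<close>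
  have gen_gen: "\<lbrakk>g, g'\<rbrakk>\<^bsub>T\<^esub> \<in> T.span tensor_gens" if "g \<in> tensor_gens" "g' \<in> tensor_gens" for g g'
  proof -
    obtain l k l' k' where *: "l \<in> carrier L" "k \<in> carrier L" "l' \<in> carrier L" "k' \<in> carrier L"
      "g = gen l k" "g' = gen l' k'"
      using \<open>g \<in> tensor_gens\<close> \<open>g' \<in> tensor_gens\<close> unfolding tensor_gens_def by blast
    then have "gen \<lbrakk>k, l\<rbrakk>\<^bsub>L\<^esub> \<lbrakk>l', k'\<rbrakk>\<^bsub>L\<^esub> \<in> T.span tensor_gens"
      unfolding tensor_gens_def by (intro in_span[unfolded tensor_gens_def]) (auto intro: bracket_closed)
    then show ?thesis using * SD(5) gen_relations(6) by simp
  qed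
  have span_gen: "\<lbrakk>v, g\<rbrakk>\<^bsub>T\<^esub> \<in> T.span tensor_gens" if "v \<in> T.span tensor_gens" "g \<in> tensor_gens" for v g
    using that(1) tensor_gens_subset
  proof (rule T.span_induct)
    have g: "g \<in> carrier T" using that tensor_gens_subset by auto
    show "\<lbrakk>\<zero>\<^bsub>T\<^esub>, g\<rbrakk>\<^bsub>T\<^esub> \<in> T.span tensor_gens" using g SD(2) by simp
    show "\<lbrakk>v \<oplus>\<^bsub>T\<^esub> w, g\<rbrakk>\<^bsub>T\<^esub> \<in> T.span tensor_gens" if "v \<in> carrier T" "w \<in> carrier T"
      "\<lbrakk>v, g\<rbrakk>\<^bsub>T\<^esub> \<in> T.span tensor_gens" "\<lbrakk>w, g\<rbrakk>\<^bsub>T\<^esub> \<in> T.span tensor_gens" for v w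
      using that g SD(3) by (simp add: T.bracket_add_left)
    show "\<lbrakk>c \<odot>\<^bsub>T\<^esub> v, g\<rbrakk>\<^bsub>T\<^esub> \<in> T.span tensor_gens" if "c \<in> carrier F" "v \<in> carrier T"
      "\<lbrakk>v, g\<rbrakk>\<^bsub>T\<^esub> \<in> T.span tensor_gens" for c v
      using that g SD(4) by (simp add: T.bracket_smult_left)
  qed (use gen_gen that in auto)
  have span_span: "\<lbrakk>v, w\<rbrakk>\<^bsub>T\<^esub> \<in> T.span tensor_gens"
    if vw: "v \<in> T.span tensor_gens" "w \<in> T.span tensor_gens" for v w
    using vw(2) tensor_gens_subset
  proof (rule T.span_induct)
    have v: "v \<in> carrier T" using vw SD(1) by auto
    show "\<lbrakk>v, \<zero>\<^bsub>T\<^esub>\<rbrakk>\<^bsub>T\<^esub> \<in> T.span tensor_gens" using v SD(2) by simp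
    show "\<lbrakk>v, w \<oplus>\<^bsub>T\<^esub> x\<rbrakk>\<^bsub>T\<^esub> \<in> T.span tensor_gens" if "w \<in> carrier T" "x \<in> carrier T"
      "\<lbrakk>v, w\<rbrakk>\<^bsub>T\<^esub> \<in> T.span tensor_gens" "\<lbrakk>v, x\<rbrakk>\<^bsub>T\<^esub> \<in> T.span tensor_gens" for w x
      using that v SD(3) by (simp add: T.bracket_add_right)
    show "\<lbrakk>v, c \<odot>\<^bsub>T\<^esub> w\<rbrakk>\<^bsub>T\<^esub> \<in> T.span tensor_gens" if "c \<in> carrier F" "w \<in> carrier T"
      "\<lbrakk>v, w\<rbrakk>\<^bsub>T\<^esub> \<in> T.span tensor_gens" for c w
      using that v SD(4) by (simp add: T.bracket_smult_right)
  qed (use span_gen vw in auto)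
  have "cls t \<in> T.span tensor_gens" if "t \<in> tensor_terms F L" for t
    using that
  proof induction
    case (1 l k)
    then show ?case by (intro in_span) (auto simp: tensor_gens_def)
  next
    case 2
    then show ?case using SD(2) by (simp add: tensor_square_simps)
  next
    case (3 s t)
    then show ?case using SD(3)[of "cls s" "cls t"] by (simp add: tensor_square_simps)
  next
    case (4 t)
    then show ?case using SD(5) by (simp add: tensor_class_neg)
  next
    case (5 c t)
    then show ?case using SD(4)[of c "cls t"] by (simp add: tensor_square_simps)
  next
    case (6 s t)
    then show ?case using span_span[of "cls s" "cls t"] by (simp add: tensor_square_simps)
  qed
  then show ?thesis using SD(1) by (auto simp: tensor_square_simps)
qed

text \<open>There is no bracket case. This makes the rule applicable to statements about a
  functional on the tensor square, which is linear but need not respect brackets.\<close>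

lemma tensor_square_induct:
  assumes "v \<in> carrier T" and "P \<zero>\<^bsub>T\<^esub>"
    and gen: "\<And>l k. \<lbrakk>l \<in> carrier L; k \<in> carrier L\<rbrakk> \<Longrightarrow> P (gen l k)"
    and "\<And>v w. \<lbrakk>v \<in> carrier T; w \<in> carrier T; P v; P w\<rbrakk> \<Longrightarrow> P (v \<oplus>\<^bsub>T\<^esub> w)"
    and "\<And>c v. \<lbrakk>c \<in> carrier F; v \<in> carrier T; P v\<rbrakk> \<Longrightarrow> P (c \<odot>\<^bsub>T\<^esub> v)"
  shows "P v"
proof -
  interpret T: lie_algebra F T by (rule lie_algebra_tensor_square)
  show ?thesis
    by (rule T.span_induct[of v tensor_gens])
      (use assms span_tensor_gens tensor_gens_subset in \<open>auto simp: tensor_gens_def\<close>)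
qed

text \<open>By bilinearity, the products of members of a spanning set of \<open>L\<close> span all
  generators, and the generators span everything as a vector space. Finite dimension of the cover is
  deduced from this.\<close>

lemma tensor_square_fin_dim:
  assumes fin_dim
  shows "vectorspace.fin_dim F T"
proof -
  interpret T: lie_algebra F T by (rule lie_algebra_tensor_square)
  obtain B where B: "finite B" "B \<subseteq> carrier L" "span B = carrier L"
    using assms unfolding fin_dim_def by auto
  define S where "S = (\<lambda>(l, k). gen l k) ` (B \<times> B)"
  have "gen l k \<in> carrier T" if "l \<in> B" "k \<in> B" for l k
    using that B(2) by (intro gen_closed) auto
  then have S: "finite S" "S \<subseteq> carrier T" using B(1) by (auto simp: S_def)
  note SD = T.subspaceD[OF T.span_is_subspace[OF S(2)]]
  note in_span = subsetD[OF T.in_own_span[OF S(2)]]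
  have gen_zero: "gen l \<zero>\<^bsub>L\<^esub> = \<zero>\<^bsub>T\<^esub>" "gen \<zero>\<^bsub>L\<^esub> l = \<zero>\<^bsub>T\<^esub>" if "l \<in> carrier L" for l
    using gen_relations(3)[of "\<zero>\<^bsub>F\<^esub>" l l] gen_relations(4)[of "\<zero>\<^bsub>F\<^esub>" l l] that by simp_all
  have *: "gen l k \<in> T.span S" if "l \<in> carrier L" "k \<in> B" for l k
  proof -
    have k: "k \<in> carrier L" using that B(2) by auto
    show ?thesis
    proof (rule span_induct[of l B])
      show "l \<in> span B" "B \<subseteq> carrier L" using that B by auto
      show "gen \<zero>\<^bsub>L\<^esub> k \<in> T.span S" using gen_zero(2)[OF k] SD(2) by simp
      show "gen l k \<in> T.span S" if "l \<in> B" for l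
        using that \<open>k \<in> B\<close> unfolding S_def by (intro in_span[unfolded S_def]) auto
      show "gen (l \<oplus>\<^bsub>L\<^esub> l') k \<in> T.span S" if "l \<in> carrier L" "l' \<in> carrier L"
        "gen l k \<in> T.span S" "gen l' k \<in> T.span S" for l l'
        using SD(3)[OF that(3,4)] gen_relations(1)[OF that(1,2) k] by simp
      show "gen (c \<odot>\<^bsub>L\<^esub> l) k \<in> T.span S" if "c \<in> carrier F" "l \<in> carrier L" "gen l k \<in> T.span S" for c l
        using SD(4)[OF that(1,3)] gen_relations(3)[OF that(1,2) k] by simp
    qed
  qed
  have "gen l k \<in> T.span S" if l: "l \<in> carrier L" and k: "k \<in> carrier L" for l k
  proof (rule span_induct[of k B])
    show "k \<in> span B" "B \<subseteq> carrier L" using k B by auto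
    show "gen l \<zero>\<^bsub>L\<^esub> \<in> T.span S" using gen_zero(1)[OF l] SD(2) by simp
    show "gen l k \<in> T.span S" if "k \<in> B" for k by (rule *[OF l that])
    show "gen l (k \<oplus>\<^bsub>L\<^esub> k') \<in> T.span S" if "k \<in> carrier L" "k' \<in> carrier L"
      "gen l k \<in> T.span S" "gen l k' \<in> T.span S" for k k'
      using SD(3)[OF that(3,4)] gen_relations(2)[OF l that(1,2)] by simp
    show "gen l (c \<odot>\<^bsub>L\<^esub> k) \<in> T.span S" if "c \<in> carrier F" "k \<in> carrier L" "gen l k \<in> T.span S" for c k
      using SD(4)[OF that(1,3)] gen_relations(4)[OF that(1) l that(2)] by simp
  qed
  then have "v \<in> T.span S" if "v \<in> carrier T" for v
    using that SD(2-4) by (intro tensor_square_induct[of v "\<lambda>v. v \<in> T.span S"]) auto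
  then have "T.span S = carrier T" using SD(1) by auto
  then show ?thesis unfolding T.fin_dim_def using S by auto
qed

end

section \<open>Universal property of the tensor square\<close>

primrec tensor_eval :: "('f, 'k) lie_algebra \<Rightarrow> ('l \<Rightarrow> 'l \<Rightarrow> 'k) \<Rightarrow> ('f, 'l) tensor_term \<Rightarrow> 'k"
  where
    "tensor_eval K b (TGen l k) = b l k"
  | "tensor_eval K b TZero = \<zero>\<^bsub>K\<^esub>"
  | "tensor_eval K b (TAdd s t) = tensor_eval K b s \<oplus>\<^bsub>K\<^esub> tensor_eval K b t"
  | "tensor_eval K b (TNeg t) = \<ominus>\<^bsub>K\<^esub> tensor_eval K b t"
  | "tensor_eval K b (TScale c t) = c \<odot>\<^bsub>K\<^esub> tensor_eval K b t"
  | "tensor_eval K b (TBracket s t) = \<lbrakk>tensor_eval K b s, tensor_eval K b t\<rbrakk>\<^bsub>K\<^esub>"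

text \<open>Formal terms are evaluated in \<open>K\<close> with the generators interpreted by
  \<open>b\<close>. Apart from congruence, every rule of \<open>tensor_eq\<close> turns into a Lie
  algebra law, valid in \<open>K\<close>, or into one of the assumptions on \<open>b\<close>, so
  congruent terms have equal values.\<close>

lemma (in lie_algebra) tensor_square_lift:
  fixes K :: "('f, 'k) lie_algebra" and b :: "'a \<Rightarrow> 'a \<Rightarrow> 'k"
  assumes K: "lie_algebra F K"
    and b_closed: "\<And>l k. \<lbrakk>l \<in> carrier L; k \<in> carrier L\<rbrakk> \<Longrightarrow> b l k \<in> carrier K"
    and b_add_left: "\<And>l l' k. \<lbrakk>l \<in> carrier L; l' \<in> carrier L; k \<in> carrier L\<rbrakk> \<Longrightarrow>
      b (l \<oplus>\<^bsub>L\<^esub> l') k = b l k \<oplus>\<^bsub>K\<^esub> b l' k"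
    and b_add_right: "\<And>l k k'. \<lbrakk>l \<in> carrier L; k \<in> carrier L; k' \<in> carrier L\<rbrakk> \<Longrightarrow>
      b l (k \<oplus>\<^bsub>L\<^esub> k') = b l k \<oplus>\<^bsub>K\<^esub> b l k'"
    and b_smult_left: "\<And>c l k. \<lbrakk>c \<in> carrier F; l \<in> carrier L; k \<in> carrier L\<rbrakk> \<Longrightarrow>
      b (c \<odot>\<^bsub>L\<^esub> l) k = c \<odot>\<^bsub>K\<^esub> b l k"
    and b_smult_right: "\<And>c l k. \<lbrakk>c \<in> carrier F; l \<in> carrier L; k \<in> carrier L\<rbrakk> \<Longrightarrow>
      b l (c \<odot>\<^bsub>L\<^esub> k) = c \<odot>\<^bsub>K\<^esub> b l k"
    and b_bracket_left: "\<And>l l' k. \<lbrakk>l \<in> carrier L; l' \<in> carrier L; k \<in> carrier L\<rbrakk> \<Longrightarrow>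
      b \<lbrakk>l, l'\<rbrakk>\<^bsub>L\<^esub> k = b l \<lbrakk>l', k\<rbrakk>\<^bsub>L\<^esub> \<oplus>\<^bsub>K\<^esub> \<ominus>\<^bsub>K\<^esub> b l' \<lbrakk>l, k\<rbrakk>\<^bsub>L\<^esub>"
    and b_bracket_right: "\<And>l k k'. \<lbrakk>l \<in> carrier L; k \<in> carrier L; k' \<in> carrier L\<rbrakk> \<Longrightarrow>
      b l \<lbrakk>k, k'\<rbrakk>\<^bsub>L\<^esub> = b \<lbrakk>k', l\<rbrakk>\<^bsub>L\<^esub> k \<oplus>\<^bsub>K\<^esub> \<ominus>\<^bsub>K\<^esub> b \<lbrakk>k, l\<rbrakk>\<^bsub>L\<^esub> k'"
    and b_gen: "\<And>l k l' k'. \<lbrakk>l \<in> carrier L; k \<in> carrier L; l' \<in> carrier L; k' \<in> carrier L\<rbrakk> \<Longrightarrow>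
      \<lbrakk>b l k, b l' k'\<rbrakk>\<^bsub>K\<^esub> = \<ominus>\<^bsub>K\<^esub> b \<lbrakk>k, l\<rbrakk>\<^bsub>L\<^esub> \<lbrakk>l', k'\<rbrakk>\<^bsub>L\<^esub>"
  obtains \<phi> where "\<phi> \<in> lie_hom F T K"
    and "\<And>l k. \<lbrakk>l \<in> carrier L; k \<in> carrier L\<rbrakk> \<Longrightarrow> \<phi> (gen l k) = b l k"
proof -
  interpret K: lie_algebra F K by fact
  let ?ev = "tensor_eval K b"
  have closed: "?ev t \<in> carrier K" if "t \<in> tensor_terms F L" for t
    using that by induction (auto simp: b_closed K.bracket_closed)
  have sound: "?ev s = ?ev t" if "tensor_eq F L s t" for s t
    using that
  proof induction
    case (te_gen_bracket_right l k k')
    then show ?case using b_bracket_right by simp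
  next
    case (te_jacobi s t u)
    then show ?case using K.jacobi[OF closed closed closed] by (simp only: tensor_eval.simps)
  qed (simp_all add: closed b_closed K.bracket_closed K.M.a_ac K.M.l_neg K.M.r_neg K.smult_l_distr K.smult_r_distr
      K.smult_assoc1 K.bracket_add_left K.bracket_add_right K.bracket_smult_left
      K.bracket_smult_right K.bracket_self b_add_left b_add_right b_smult_left
      b_smult_right b_bracket_left b_gen)
  \<comment> \<open>Which representative is chosen does not matter, by \<open>sound\<close>.\<close>
  define \<phi> where "\<phi> A = ?ev (SOME t. t \<in> A)" for A
  have \<phi>: "\<phi> (cls t) = ?ev t" if "t \<in> tensor_terms F L" for t
  proof -
    have "t \<in> cls t" using te_refl[OF that] by (simp add: tensor_class_def)
    then have "(SOME s. s \<in> cls t) \<in> cls t" by (rule someI)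
    then show ?thesis unfolding \<phi>_def using sound by (auto simp: tensor_class_def)
  qed
  show thesis
  proof (rule that)
    show "\<phi> \<in> lie_hom F T K"
      unfolding lie_hom_def module_hom_def
      by (auto simp: tensor_square_simps \<phi> closed tensor_terms.intros)
    show "\<phi> (gen l k) = b l k" if "l \<in> carrier L" "k \<in> carrier L" for l k
      using that \<phi>[of "TGen l k"] by (simp add: tensor_terms.intros)
  qed
qed

subsection \<open>Quotients\<close>

text \<open>The cosets of the kernel are the fibres of \<open>\<phi>\<close>, and the image of a
  result under \<open>\<phi>\<close> depends only on the images of its arguments. Hence the set sum
  and the unions in \<open>lie_quotient\<close> collapse to single fibres. The target is
  \<open>K\<close> with a smaller carrier because \<open>lie_derived\<close> has that shape.\<close>

lemma lie_first_isomorphism: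
  fixes T :: "('f, 't) lie_algebra" and K :: "('f, 'k) lie_algebra"
  assumes "lie_algebra F T" "lie_algebra F K" and \<phi>: "\<phi> \<in> lie_hom F T K"
    and D: "D = {x \<in> carrier T. \<phi> x = \<zero>\<^bsub>K\<^esub>}"
  shows "lie_isomorphic F (lie_quotient T D) (K\<lparr>carrier := \<phi> ` carrier T\<rparr>)"
proof -
  interpret T: lie_algebra F T by fact
  interpret K: lie_algebra F K by fact
  interpret \<phi>: linear_map F T K \<phi> by (rule lie_hom_linear_map) fact+
  note \<phi>_bracket = lie_hom_bracket[OF \<phi>]
  define fib where "fib a = {x \<in> carrier T. \<phi> x = \<phi> a}" for a
  have shift: "x = (x \<ominus>\<^bsub>T\<^esub> a) \<oplus>\<^bsub>T\<^esub> a" if "x \<in> carrier T" "a \<in> carrier T" for x a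
    using that by (simp add: a_minus_def T.M.a_assoc T.M.l_neg)
  have coset: "D +>\<^bsub>T\<^esub> a = fib a" if a: "a \<in> carrier T" for a
  proof
    show "D +>\<^bsub>T\<^esub> a \<subseteq> fib a"
      using a by (auto simp: D a_r_coset_def' fib_def)
    show "fib a \<subseteq> D +>\<^bsub>T\<^esub> a"
    proof
      fix x assume "x \<in> fib a"
      then have x: "x \<in> carrier T" "\<phi> x = \<phi> a" by (auto simp: fib_def)
      then have "x \<ominus>\<^bsub>T\<^esub> a \<in> D" using a by (simp add: D)
      then show "x \<in> D +>\<^bsub>T\<^esub> a" unfolding a_r_coset_def' using shift[OF x(1) a] by blast
    qed
  qed
  have fib_cong: "fib a = fib b" if "\<phi> a = \<phi> b" for a b using that by (simp add: fib_def)
  have fib_self: "a \<in> fib a" if "a \<in> carrier T" for a using that by (simp add: fib_def)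
  let ?Q = "lie_quotient T D"
  have Q_carrier: "carrier ?Q = fib ` carrier T"
    by (auto simp: lie_quotient_def A_RCOSETS_def' coset)
  have Q_add: "fib a \<oplus>\<^bsub>?Q\<^esub> fib b = fib (a \<oplus>\<^bsub>T\<^esub> b)" if ab: "a \<in> carrier T" "b \<in> carrier T" for a b
  proof -
    have "fib a <+>\<^bsub>T\<^esub> fib b = fib (a \<oplus>\<^bsub>T\<^esub> b)"
    proof
      show "fib a <+>\<^bsub>T\<^esub> fib b \<subseteq> fib (a \<oplus>\<^bsub>T\<^esub> b)"
        using ab by (auto simp: set_add_def' fib_def)
      show "fib (a \<oplus>\<^bsub>T\<^esub> b) \<subseteq> fib a <+>\<^bsub>T\<^esub> fib b"
      proof
        fix x assume "x \<in> fib (a \<oplus>\<^bsub>T\<^esub> b)"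
        then have x: "x \<in> carrier T" "\<phi> x = \<phi> a \<oplus>\<^bsub>K\<^esub> \<phi> b" using ab by (auto simp: fib_def)
        then have "x \<ominus>\<^bsub>T\<^esub> b \<in> fib a"
          using ab by (simp add: fib_def a_minus_def K.M.a_assoc K.M.r_neg)
        then show "x \<in> fib a <+>\<^bsub>T\<^esub> fib b"
          unfolding set_add_def' using shift[OF x(1) ab(2)] fib_self[OF ab(2)] by blast
      qed
    qed
    then show ?thesis by (simp add: lie_quotient_def)
  qed
  have Q_smult: "c \<odot>\<^bsub>?Q\<^esub> fib a = fib (c \<odot>\<^bsub>T\<^esub> a)" if ca: "c \<in> carrier F" "a \<in> carrier T" for c a
  proof -
    have "D +>\<^bsub>T\<^esub> (c \<odot>\<^bsub>T\<^esub> x) = fib (c \<odot>\<^bsub>T\<^esub> a)" if "x \<in> fib a" for x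
      using that ca by (subst coset) (auto simp: fib_def)
    then have "(\<Union>x\<in>fib a. D +>\<^bsub>T\<^esub> (c \<odot>\<^bsub>T\<^esub> x)) = fib (c \<odot>\<^bsub>T\<^esub> a)"
      using fib_self[OF ca(2)] by blast
    then show ?thesis by (simp add: lie_quotient_def)
  qed
  have Q_bracket: "\<lbrakk>fib a, fib b\<rbrakk>\<^bsub>?Q\<^esub> = fib \<lbrakk>a, b\<rbrakk>\<^bsub>T\<^esub>" if ab: "a \<in> carrier T" "b \<in> carrier T" for a b
  proof -
    have "D +>\<^bsub>T\<^esub> \<lbrakk>x, y\<rbrakk>\<^bsub>T\<^esub> = fib \<lbrakk>a, b\<rbrakk>\<^bsub>T\<^esub>" if "x \<in> fib a" "y \<in> fib b" for x y
      using that ab by (subst coset) (auto simp: fib_def T.bracket_closed \<phi>_bracket)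
    then have "(\<Union>x\<in>fib a. \<Union>y\<in>fib b. D +>\<^bsub>T\<^esub> \<lbrakk>x, y\<rbrakk>\<^bsub>T\<^esub>) = fib \<lbrakk>a, b\<rbrakk>\<^bsub>T\<^esub>"
      using fib_self[OF ab(1)] fib_self[OF ab(2)] by blast
    then show ?thesis by (simp add: lie_quotient_def)
  qed
  \<comment> \<open>All members of a fibre have the same image, so any of them may be
    evaluated.\<close>
  define h where "h A = \<phi> (SOME a. a \<in> A)" for A
  have h: "h (fib a) = \<phi> a" if "a \<in> carrier T" for a
    using someI[of "\<lambda>x. x \<in> fib a", OF fib_self[OF that]] by (simp add: h_def fib_def)
  show ?thesis
    unfolding lie_isomorphic_def
  proof
    show "h \<in> lie_hom F ?Q (K\<lparr>carrier := \<phi> ` carrier T\<rparr>)"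
      unfolding lie_hom_def module_hom_def
      by (auto simp: Q_carrier Q_add Q_smult Q_bracket h T.bracket_closed \<phi>_bracket)
    show "bij_betw h (carrier ?Q) (carrier (K\<lparr>carrier := \<phi> ` carrier T\<rparr>))"
      unfolding bij_betw_def
    proof
      show "inj_on h (carrier ?Q)"
      proof (rule inj_onI)
        fix A B assume AB: "A \<in> carrier ?Q" "B \<in> carrier ?Q" and eq: "h A = h B"
        obtain a b where *: "a \<in> carrier T" "b \<in> carrier T" "A = fib a" "B = fib b"
          using AB unfolding Q_carrier by blast
        then have "\<phi> a = \<phi> b" using eq h by simp
        then show "A = B" unfolding * by (rule fib_cong)
      qed
    qed (auto simp: Q_carrier h image_image)
  qed
qed

section \<open>Central extensions and the tensor square\<close>

lemma (in lie_cocycle) cocycle_zero_left: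
  assumes "y \<in> carrier K"
  shows "f \<zero>\<^bsub>K\<^esub> y = \<zero>\<^bsub>F\<^esub>"
  using cocycle_smult_left[of "\<zero>\<^bsub>F\<^esub>" "\<zero>\<^bsub>K\<^esub>" y] assms by (simp add: cocycle_closed)

text \<open>The functional yields a cocycle on \<open>L\<close>, while the algebra to be enlarged is
  \<open>K\<close>. A form that is pulled back vanishes as soon as one argument lies in the kernel
  of \<open>p\<close>, so this kernel stays central in the extension.\<close>

lemma lie_cocycle_pullback:
  assumes K: "lie_algebra F K" and L: "lie_cocycle F L f" and p: "p \<in> lie_hom F K L"
  shows "lie_cocycle F K (\<lambda>x y. f (p x) (p y))"
proof -
  interpret K: lie_algebra F K by fact
  interpret L: lie_cocycle F L f by fact
  interpret p: linear_map F K L p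
    by (rule lie_hom_linear_map[OF K L.lie_algebra_axioms p])
  show ?thesis
    by (intro lie_cocycle.intro lie_cocycle_axioms.intro K)
      (simp_all add: lie_hom_bracket[OF p] L.bracket_closed L.cocycle_closed L.cocycle_add_left
        L.cocycle_add_right L.cocycle_smult_left L.cocycle_smult_right L.cocycle_self L.cocycle_jacobi)
qed

text \<open>A linear functional on the exterior square is the same thing as an alternating form whose
  cocycle identity is relation (iii).\<close>

lemma (in lie_algebra) exterior_functional_cocycle:
  assumes closed: "f \<in> carrier T \<rightarrow> carrier F"
    and add: "\<And>v w. \<lbrakk>v \<in> carrier T; w \<in> carrier T\<rbrakk> \<Longrightarrow> f (v \<oplus>\<^bsub>T\<^esub> w) = f v \<oplus>\<^bsub>F\<^esub> f w"
    and smult: "\<And>c v. \<lbrakk>c \<in> carrier F; v \<in> carrier T\<rbrakk> \<Longrightarrow> f (c \<odot>\<^bsub>T\<^esub> v) = c \<otimes>\<^bsub>F\<^esub> f v"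
    and diag: "\<And>l. l \<in> carrier L \<Longrightarrow> f (gen l l) = \<zero>\<^bsub>F\<^esub>"
  shows "lie_cocycle F L (\<lambda>l k. f (gen l k))"
proof -
  interpret T: lie_algebra F T by (rule lie_algebra_tensor_square)
  have f_closed: "f v \<in> carrier F" if "v \<in> carrier T" for v using closed that by auto
  have neg: "f (\<ominus>\<^bsub>T\<^esub> v) = \<ominus>\<^bsub>F\<^esub> f v" if "v \<in> carrier T" for v
    using smult[of "\<ominus>\<^bsub>F\<^esub> \<one>\<^bsub>F\<^esub>" v] that by (simp add: T.smult_minus_1 R.l_minus f_closed)
  have gen_neg: "gen l (\<ominus>\<^bsub>L\<^esub> k) = \<ominus>\<^bsub>T\<^esub> gen l k" if "l \<in> carrier L" "k \<in> carrier L" for l k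
    using gen_relations(4)[of "\<ominus>\<^bsub>F\<^esub> \<one>\<^bsub>F\<^esub>" l k] that by (simp add: T.smult_minus_1 smult_minus_1)
  \<comment> \<open>Only the diagonal is known to vanish; polarising at \<open>l + k\<close> gives
    the skew symmetry that the cocycle identity requires.\<close>
  have antisym: "f (gen l k) = \<ominus>\<^bsub>F\<^esub> f (gen k l)" if "l \<in> carrier L" "k \<in> carrier L" for l k
  proof -
    have "f (gen l k) \<oplus>\<^bsub>F\<^esub> f (gen k l)
        = (f (gen l l) \<oplus>\<^bsub>F\<^esub> f (gen k l)) \<oplus>\<^bsub>F\<^esub> (f (gen l k) \<oplus>\<^bsub>F\<^esub> f (gen k k))"
      using that by (simp add: diag f_closed R.a_comm)
    also have "\<dots> = f (gen (l \<oplus>\<^bsub>L\<^esub> k) (l \<oplus>\<^bsub>L\<^esub> k))"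
      using that by (simp only: gen_relations(1,2) add gen_closed M.a_closed T.M.a_closed)
    also have "\<dots> = \<zero>\<^bsub>F\<^esub>" using that by (intro diag) simp
    finally show ?thesis
      using that by (intro R.minus_equality[symmetric]) (auto simp: f_closed)
  qed
  show ?thesis
  proof (intro lie_cocycle.intro lie_cocycle_axioms.intro)
    show "lie_algebra F L" ..
    fix x y z assume xyz: "x \<in> carrier L" "y \<in> carrier L" "z \<in> carrier L"
    note br = bracket_closed[OF xyz(2,3)] bracket_closed[OF xyz(3,1)] bracket_closed[OF xyz(1,2)]
      bracket_closed[OF xyz(1,3)]
    have "f (gen y \<lbrakk>x, z\<rbrakk>\<^bsub>L\<^esub>) = \<ominus>\<^bsub>F\<^esub> f (gen y \<lbrakk>z, x\<rbrakk>\<^bsub>L\<^esub>)"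
      using xyz br by (subst bracket_antisym) (auto simp: gen_neg neg)
    \<comment> \<open>This is the first half of (iii) with its sign absorbed by reversing the inner
      bracket. Moving \<open>z\<close> to the front with \<open>antisym\<close> then leaves the
      cyclic cocycle identity.\<close>
    then have "f (gen \<lbrakk>x, y\<rbrakk>\<^bsub>L\<^esub> z) = f (gen x \<lbrakk>y, z\<rbrakk>\<^bsub>L\<^esub>) \<oplus>\<^bsub>F\<^esub> f (gen y \<lbrakk>z, x\<rbrakk>\<^bsub>L\<^esub>)"
      using xyz br by (simp add: gen_relations(5) add neg f_closed)
    then show "f (gen x \<lbrakk>y, z\<rbrakk>\<^bsub>L\<^esub>) \<oplus>\<^bsub>F\<^esub> f (gen y \<lbrakk>z, x\<rbrakk>\<^bsub>L\<^esub>) \<oplus>\<^bsub>F\<^esub> f (gen z \<lbrakk>x, y\<rbrakk>\<^bsub>L\<^esub>) = \<zero>\<^bsub>F\<^esub>"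
      using xyz br antisym[OF xyz(3) br(3)] by (simp add: f_closed R.r_neg)
  qed (simp_all add: f_closed gen_relations(1-4) add smult diag)
qed

text \<open>As the kernel of \<open>p\<close> is central, \<open>\<lbrakk>x, y\<rbrakk>\<close> depends only on \<open>p x\<close> and \<open>p y\<close>.\<close>

lemma commutator_lift:
  fixes K :: "('f, 'k) lie_algebra" and L :: "('f, 'l) lie_algebra"
  assumes K: "lie_algebra F K" and L: "lie_algebra F L"
    and p: "p \<in> lie_hom F K L" and surj: "p ` carrier K = carrier L"
    and central: "{x \<in> carrier K. p x = \<zero>\<^bsub>L\<^esub>} \<subseteq> lie_center K"
  obtains \<phi> where "\<phi> \<in> lie_hom F (tensor_square F L) K"
    and "\<And>x y. \<lbrakk>x \<in> carrier K; y \<in> carrier K\<rbrakk> \<Longrightarrow> \<phi> (tensor_class F L (TGen (p x) (p y))) = \<lbrakk>x, y\<rbrakk>\<^bsub>K\<^esub>"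
proof -
  interpret K: lie_algebra F K by fact
  interpret L: lie_algebra F L by fact
  interpret p: linear_map F K L p by (rule lie_hom_linear_map[OF K L p])
  \<comment> \<open>A set-theoretic section of \<open>p\<close>, not linear in general. Bilinearity
    of \<open>b\<close> rests on the independence of the lifts, which \<open>cong_left\<close>
    prepares.\<close>
  define s where "s = inv_into (carrier K) p"
  have s: "s l \<in> carrier K" "p (s l) = l" if "l \<in> carrier L" for l
    using that surj unfolding s_def by (auto intro: inv_into_into f_inv_into_f)
  have cong_left: "\<lbrakk>x, y\<rbrakk>\<^bsub>K\<^esub> = \<lbrakk>x', y\<rbrakk>\<^bsub>K\<^esub>"
    if "p x = p x'" "x \<in> carrier K" "x' \<in> carrier K" "y \<in> carrier K" for x x' y
  proof -
    have "x \<oplus>\<^bsub>K\<^esub> \<ominus>\<^bsub>K\<^esub> x' \<in> lie_center K"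
      using that by (intro subsetD[OF central]) (simp add: L.M.r_neg)
    then have "\<lbrakk>x \<oplus>\<^bsub>K\<^esub> \<ominus>\<^bsub>K\<^esub> x', y\<rbrakk>\<^bsub>K\<^esub> = \<zero>\<^bsub>K\<^esub>" using that by (simp add: lie_center_def)
    then have "\<lbrakk>x, y\<rbrakk>\<^bsub>K\<^esub> \<ominus>\<^bsub>K\<^esub> \<lbrakk>x', y\<rbrakk>\<^bsub>K\<^esub> = \<zero>\<^bsub>K\<^esub>"
      using that by (simp add: K.bracket_add_left K.bracket_neg_left a_minus_def)
    then show ?thesis using that by (simp add: K.bracket_closed)
  qed
  define b where "b l k = \<lbrakk>s l, s k\<rbrakk>\<^bsub>K\<^esub>" for l k
  have b: "b (p x) (p y) = \<lbrakk>x, y\<rbrakk>\<^bsub>K\<^esub>" if xy: "x \<in> carrier K" "y \<in> carrier K" for x y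
  proof -
    have sx: "s (p x) \<in> carrier K" "p (s (p x)) = p x" and sy: "s (p y) \<in> carrier K" "p (s (p y)) = p y"
      using xy by (auto intro: s)
    have "b (p x) (p y) = \<lbrakk>x, s (p y)\<rbrakk>\<^bsub>K\<^esub>" unfolding b_def using cong_left xy sx sy by blast
    also have "\<dots> = \<ominus>\<^bsub>K\<^esub> \<lbrakk>s (p y), x\<rbrakk>\<^bsub>K\<^esub>" using xy sy by (intro K.bracket_antisym)
    also have "\<lbrakk>s (p y), x\<rbrakk>\<^bsub>K\<^esub> = \<lbrakk>y, x\<rbrakk>\<^bsub>K\<^esub>" using cong_left xy sy by blast
    also have "\<ominus>\<^bsub>K\<^esub> \<lbrakk>y, x\<rbrakk>\<^bsub>K\<^esub> = \<lbrakk>x, y\<rbrakk>\<^bsub>K\<^esub>" using K.bracket_antisym[OF xy] by simp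
    finally show ?thesis .
  qed
  have lift: "\<exists>x\<in>carrier K. l = p x" if "l \<in> carrier L" for l using that surj by blast
  \<comment> \<open>The Jacobi identity as a derivation rule, which is the shape of the first half
    of (iii).\<close>
  have jac: "\<lbrakk>\<lbrakk>x, x'\<rbrakk>\<^bsub>K\<^esub>, y\<rbrakk>\<^bsub>K\<^esub> = \<lbrakk>x, \<lbrakk>x', y\<rbrakk>\<^bsub>K\<^esub>\<rbrakk>\<^bsub>K\<^esub> \<oplus>\<^bsub>K\<^esub> \<ominus>\<^bsub>K\<^esub> \<lbrakk>x', \<lbrakk>x, y\<rbrakk>\<^bsub>K\<^esub>\<rbrakk>\<^bsub>K\<^esub>"
    if xy: "x \<in> carrier K" "x' \<in> carrier K" "y \<in> carrier K" for x x' y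
  proof -
    have "\<lbrakk>x', \<lbrakk>y, x\<rbrakk>\<^bsub>K\<^esub>\<rbrakk>\<^bsub>K\<^esub> = \<ominus>\<^bsub>K\<^esub> \<lbrakk>x', \<lbrakk>x, y\<rbrakk>\<^bsub>K\<^esub>\<rbrakk>\<^bsub>K\<^esub>"
      using xy K.bracket_antisym[OF xy(3,1)] by (simp add: K.bracket_neg_right K.bracket_closed)
    then have "(\<lbrakk>x, \<lbrakk>x', y\<rbrakk>\<^bsub>K\<^esub>\<rbrakk>\<^bsub>K\<^esub> \<oplus>\<^bsub>K\<^esub> \<ominus>\<^bsub>K\<^esub> \<lbrakk>x', \<lbrakk>x, y\<rbrakk>\<^bsub>K\<^esub>\<rbrakk>\<^bsub>K\<^esub>) \<oplus>\<^bsub>K\<^esub> \<lbrakk>y, \<lbrakk>x, x'\<rbrakk>\<^bsub>K\<^esub>\<rbrakk>\<^bsub>K\<^esub> = \<zero>\<^bsub>K\<^esub>"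
      using K.jacobi[OF xy] by simp
    then have "\<ominus>\<^bsub>K\<^esub> \<lbrakk>y, \<lbrakk>x, x'\<rbrakk>\<^bsub>K\<^esub>\<rbrakk>\<^bsub>K\<^esub> = \<lbrakk>x, \<lbrakk>x', y\<rbrakk>\<^bsub>K\<^esub>\<rbrakk>\<^bsub>K\<^esub> \<oplus>\<^bsub>K\<^esub> \<ominus>\<^bsub>K\<^esub> \<lbrakk>x', \<lbrakk>x, y\<rbrakk>\<^bsub>K\<^esub>\<rbrakk>\<^bsub>K\<^esub>"
      using xy by (intro K.M.minus_equality) (auto simp: K.bracket_closed)
    then show ?thesis
      using xy K.bracket_antisym[of "\<lbrakk>x, x'\<rbrakk>\<^bsub>K\<^esub>" y] by (simp add: K.bracket_closed)
  qed
  obtain \<phi> where \<phi>: "\<phi> \<in> lie_hom F (tensor_square F L) K"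
    "\<And>l k. \<lbrakk>l \<in> carrier L; k \<in> carrier L\<rbrakk> \<Longrightarrow> \<phi> (tensor_class F L (TGen l k)) = b l k"
  proof (rule L.tensor_square_lift[OF K, of b])
    fix l l' k assume "l \<in> carrier L" "l' \<in> carrier L" "k \<in> carrier L"
    then obtain x x' y where *: "x \<in> carrier K" "x' \<in> carrier K" "y \<in> carrier K"
      "l = p x" "l' = p x'" "k = p y" using lift by metis
    note [simp] = lie_hom_bracket[OF p, symmetric] p.f_add[symmetric] p.f_smult[symmetric] b
      K.bracket_closed
    note [simp del] = p.f_add p.f_smult
    show "b l k \<in> carrier K" using * by simp
    show "b (l \<oplus>\<^bsub>L\<^esub> l') k = b l k \<oplus>\<^bsub>K\<^esub> b l' k" using * by (simp add: K.bracket_add_left)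
    show "b l (l' \<oplus>\<^bsub>L\<^esub> k) = b l l' \<oplus>\<^bsub>K\<^esub> b l k" using * by (simp add: K.bracket_add_right)
    show "b (c \<odot>\<^bsub>L\<^esub> l) k = c \<odot>\<^bsub>K\<^esub> b l k" "b l (c \<odot>\<^bsub>L\<^esub> k) = c \<odot>\<^bsub>K\<^esub> b l k" if "c \<in> carrier F" for c
      using * that by (simp_all add: K.bracket_smult_left K.bracket_smult_right)
    show "b \<lbrakk>l, l'\<rbrakk>\<^bsub>L\<^esub> k = b l \<lbrakk>l', k\<rbrakk>\<^bsub>L\<^esub> \<oplus>\<^bsub>K\<^esub> \<ominus>\<^bsub>K\<^esub> b l' \<lbrakk>l, k\<rbrakk>\<^bsub>L\<^esub>"
      using * by (simp add: jac)
    \<comment> \<open>The second half of (iii): reverse the outer bracket, apply \<open>jac\<close>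
      to \<open>x'\<close>, \<open>y\<close>, \<open>x\<close>, and reverse the two outer brackets
      that result.\<close>
    have "\<lbrakk>x, \<lbrakk>x', y\<rbrakk>\<^bsub>K\<^esub>\<rbrakk>\<^bsub>K\<^esub> = \<ominus>\<^bsub>K\<^esub> (\<lbrakk>x', \<lbrakk>y, x\<rbrakk>\<^bsub>K\<^esub>\<rbrakk>\<^bsub>K\<^esub> \<oplus>\<^bsub>K\<^esub> \<ominus>\<^bsub>K\<^esub> \<lbrakk>y, \<lbrakk>x', x\<rbrakk>\<^bsub>K\<^esub>\<rbrakk>\<^bsub>K\<^esub>)"
      using * K.bracket_antisym[of x "\<lbrakk>x', y\<rbrakk>\<^bsub>K\<^esub>"] by (simp add: jac)
    also have "\<dots> = \<ominus>\<^bsub>K\<^esub> \<lbrakk>x', \<lbrakk>y, x\<rbrakk>\<^bsub>K\<^esub>\<rbrakk>\<^bsub>K\<^esub> \<oplus>\<^bsub>K\<^esub> \<lbrakk>y, \<lbrakk>x', x\<rbrakk>\<^bsub>K\<^esub>\<rbrakk>\<^bsub>K\<^esub>"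
      using * by (simp add: K.M.minus_add)
    also have "\<dots> = \<lbrakk>\<lbrakk>y, x\<rbrakk>\<^bsub>K\<^esub>, x'\<rbrakk>\<^bsub>K\<^esub> \<oplus>\<^bsub>K\<^esub> \<ominus>\<^bsub>K\<^esub> \<lbrakk>\<lbrakk>x', x\<rbrakk>\<^bsub>K\<^esub>, y\<rbrakk>\<^bsub>K\<^esub>"
      using * K.bracket_antisym[of "\<lbrakk>y, x\<rbrakk>\<^bsub>K\<^esub>" x'] K.bracket_antisym[of y "\<lbrakk>x', x\<rbrakk>\<^bsub>K\<^esub>"] by simp
    finally show "b l \<lbrakk>l', k\<rbrakk>\<^bsub>L\<^esub> = b \<lbrakk>k, l\<rbrakk>\<^bsub>L\<^esub> l' \<oplus>\<^bsub>K\<^esub> \<ominus>\<^bsub>K\<^esub> b \<lbrakk>l', l\<rbrakk>\<^bsub>L\<^esub> k"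
      using * by simp
    fix k' assume "k' \<in> carrier L"
    then obtain y' where y': "y' \<in> carrier K" "k' = p y'" using lift by metis
    \<comment> \<open>In \<open>K\<close>, relation (iv) is just skew symmetry inside the first
      argument of a double commutator.\<close>
    show "\<lbrakk>b l k, b l' k'\<rbrakk>\<^bsub>K\<^esub> = \<ominus>\<^bsub>K\<^esub> b \<lbrakk>k, l\<rbrakk>\<^bsub>L\<^esub> \<lbrakk>l', k'\<rbrakk>\<^bsub>L\<^esub>"
      using * y' K.bracket_antisym[of x y] by (simp add: K.bracket_neg_left)
  qed blast
  show thesis
    by (rule that[OF \<phi>(1)]) (simp add: \<phi>(2) b)
qed

text \<open>Every pair of elements of \<open>L\<close> lifts to \<open>K\<close>, so the values of
  \<open>\<phi>\<close> on generators are exactly the commutators of \<open>K\<close>, and linearity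
  passes from these to the spans.\<close>

lemma commutator_lift_image:
  assumes K: "lie_algebra F K" and L: "lie_algebra F L"
    and p: "p \<in> lie_hom F K L" and surj: "p ` carrier K = carrier L"
    and \<phi>: "\<phi> \<in> lie_hom F (tensor_square F L) K"
    and \<phi>_gen: "\<And>x y. \<lbrakk>x \<in> carrier K; y \<in> carrier K\<rbrakk> \<Longrightarrow>
      \<phi> (tensor_class F L (TGen (p x) (p y))) = \<lbrakk>x, y\<rbrakk>\<^bsub>K\<^esub>"
  shows "\<phi> ` carrier (tensor_square F L) = carrier (lie_derived F K)"
proof
  interpret K: lie_algebra F K by fact
  interpret L: lie_algebra F L by fact
  interpret T: lie_algebra F "tensor_square F L" by (rule L.lie_algebra_tensor_square)
  interpret p: linear_map F K L p by (rule lie_hom_linear_map[OF K L p])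
  interpret \<phi>: linear_map F "tensor_square F L" K \<phi>
    by (rule lie_hom_linear_map[OF T.lie_algebra_axioms K \<phi>])
  note KD = K.subspaceD[OF K.subspace_derived]
  show "\<phi> ` carrier (tensor_square F L) \<subseteq> carrier (lie_derived F K)"
  proof
    fix z assume "z \<in> \<phi> ` carrier (tensor_square F L)"
    then obtain v where v: "v \<in> carrier (tensor_square F L)" "z = \<phi> v" by blast
    from v(1) have "\<phi> v \<in> carrier (lie_derived F K)"
    proof (rule L.tensor_square_induct)
      fix l k assume "l \<in> carrier L" "k \<in> carrier L"
      then obtain x y where "x \<in> carrier K" "y \<in> carrier K" "l = p x" "k = p y"
        using surj by blast
      then show "\<phi> (tensor_class F L (TGen l k)) \<in> carrier (lie_derived F K)"
        by (simp add: \<phi>_gen K.bracket_in_derived)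
    qed (simp_all add: KD)
    then show "z \<in> carrier (lie_derived F K)" using v by simp
  qed
  show "carrier (lie_derived F K) \<subseteq> \<phi> ` carrier (tensor_square F L)"
    unfolding K.carrier_derived
  proof (rule K.span_is_subset)
    show "submodule F (\<phi> ` carrier (tensor_square F L)) K"
      using \<phi>.im_is_submodule by (simp add: \<phi>.im_def)
    show "{\<lbrakk>x, y\<rbrakk>\<^bsub>K\<^esub> | x y. x \<in> carrier K \<and> y \<in> carrier K} \<subseteq> \<phi> ` carrier (tensor_square F L)"
    proof clarify
      fix x y assume xy: "x \<in> carrier K" "y \<in> carrier K"
      then have "tensor_class F L (TGen (p x) (p y)) \<in> carrier (tensor_square F L)" by simp
      then show "\<lbrakk>x, y\<rbrakk>\<^bsub>K\<^esub> \<in> \<phi> ` carrier (tensor_square F L)"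
        using \<phi>_gen[OF xy, symmetric] by blast
    qed
  qed
qed

text \<open>\<open>K\<close> is an extension of the finite dimensional \<open>L\<close> by a kernel
  that the finite dimensional \<open>V\<close> covers. The images of a spanning set of
  \<open>V\<close> and lifts of a spanning set of \<open>L\<close> together span \<open>K\<close>.
  It is applied with the tensor square as \<open>V\<close>.\<close>

lemma stem_extension_fin_dim:
  assumes V: "vectorspace F V" "vectorspace.fin_dim F V" and L: "vectorspace F L" "vectorspace.fin_dim F L"
    and \<phi>: "linear_map F V K \<phi>" and p: "linear_map F K L p" and surj: "p ` carrier K = carrier L"
    and ker: "{x \<in> carrier K. p x = \<zero>\<^bsub>L\<^esub>} \<subseteq> \<phi> ` carrier V"
  shows "vectorspace.fin_dim F K"
proof -
  interpret V: vectorspace F V by fact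
  interpret L: vectorspace F L by fact
  interpret K: vectorspace F K using p by (simp add: linear_map_def)
  interpret \<phi>: linear_map F V K \<phi> by fact
  interpret p: linear_map F K L p by fact
  obtain G where G: "finite G" "G \<subseteq> carrier V" "V.span G = carrier V"
    using V(2) unfolding V.fin_dim_def by auto
  obtain B where B: "finite B" "B \<subseteq> carrier L" "L.span B = carrier L"
    using L(2) unfolding L.fin_dim_def by auto
  define S where "S = \<phi> ` G \<union> inv_into (carrier K) p ` B"
  have lift: "inv_into (carrier K) p l \<in> carrier K" "p (inv_into (carrier K) p l) = l" if "l \<in> B" for l
  proof -
    have "l \<in> p ` carrier K" using that B(2) surj by auto
    then show "inv_into (carrier K) p l \<in> carrier K" "p (inv_into (carrier K) p l) = l"
      by (rule inv_into_into, rule f_inv_into_f)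
  qed
  have S: "finite S" "S \<subseteq> carrier K"
    using G(1,2) B(1) lift by (auto simp: S_def)
  note SD = K.subspaceD[OF K.span_is_subspace[OF S(2)]]
  note in_span = subsetD[OF K.in_own_span[OF S(2)]]
  have image: "\<phi> v \<in> K.span S" if "v \<in> carrier V" for v
  proof (rule V.span_induct[of v G])
    show "v \<in> V.span G" "G \<subseteq> carrier V" using that G by auto
    show "\<phi> v \<in> K.span S" if "v \<in> G" for v using that by (intro in_span) (auto simp: S_def)
  qed (simp_all add: SD)
  have cover: "\<exists>y\<in>K.span S. p y = l" if "l \<in> carrier L" for l
  proof (rule L.span_induct[of l B])
    show "l \<in> L.span B" "B \<subseteq> carrier L" using that B by auto
    show "\<exists>y\<in>K.span S. p y = \<zero>\<^bsub>L\<^esub>" using SD(2) p.f0_is_0 by blast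
    show "\<exists>y\<in>K.span S. p y = l" if "l \<in> B" for l
    proof
      show "p (inv_into (carrier K) p l) = l" by (rule lift[OF that])
      show "inv_into (carrier K) p l \<in> K.span S" using that unfolding S_def by (intro in_span[unfolded S_def]) auto
    qed
    show "\<exists>y\<in>K.span S. p y = l \<oplus>\<^bsub>L\<^esub> l'" if ex: "\<exists>y\<in>K.span S. p y = l" "\<exists>y\<in>K.span S. p y = l'" for l l'
    proof -
      obtain y y' where *: "y \<in> K.span S" "y' \<in> K.span S" "p y = l" "p y' = l'" using ex by blast
      then have "p (y \<oplus>\<^bsub>K\<^esub> y') = l \<oplus>\<^bsub>L\<^esub> l'" using p.f_add[of y y'] SD(1) by blast
      then show ?thesis using SD(3)[OF *(1,2)] by blast
    qed
    show "\<exists>y\<in>K.span S. p y = c \<odot>\<^bsub>L\<^esub> l" if c: "c \<in> carrier F" and ex: "\<exists>y\<in>K.span S. p y = l" for c l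
    proof -
      obtain y where *: "y \<in> K.span S" "p y = l" using ex by blast
      then have "p (c \<odot>\<^bsub>K\<^esub> y) = c \<odot>\<^bsub>L\<^esub> l" using p.f_smult[of c y] SD(1) c by blast
      then show ?thesis using SD(4)[OF c *(1)] by blast
    qed
  qed
  \<comment> \<open>Subtract from \<open>x\<close> an element of the span with the same image under
    \<open>p\<close>; the difference lies in the kernel, hence in the image of
    \<open>\<phi>\<close>, which the span contains.\<close>
  have "x \<in> K.span S" if x: "x \<in> carrier K" for x
  proof -
    obtain y where y: "y \<in> K.span S" "p y = p x" using cover[OF p.f_im[OF x]] by blast
    have yK: "y \<in> carrier K" using y SD(1) by auto
    have "x \<ominus>\<^bsub>K\<^esub> y \<in> {x \<in> carrier K. p x = \<zero>\<^bsub>L\<^esub>}" using x yK y(2) by simp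
    then obtain v where "v \<in> carrier V" "x \<ominus>\<^bsub>K\<^esub> y = \<phi> v" using ker by blast
    then have "x \<ominus>\<^bsub>K\<^esub> y \<in> K.span S" using image by simp
    then have "(x \<ominus>\<^bsub>K\<^esub> y) \<oplus>\<^bsub>K\<^esub> y \<in> K.span S" using y(1) by (rule SD(3))
    then show ?thesis using x yK by (simp add: a_minus_def K.M.a_assoc K.M.l_neg)
  qed
  then have "K.span S = carrier K" using SD(1) by auto
  then show ?thesis unfolding K.fin_dim_def using S by auto
qed

section \<open>The exterior square and the derived subalgebra of a cover\<close>

theorem theorem2p9:
  fixes F :: "('f, 'r) ring_scheme"
    and L :: "('f, 'l) lie_algebra"
    and K :: "('f, 'k) lie_algebra"
  assumes "lie_algebra F L"
    and "vectorspace.fin_dim F L"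
    and "lie_cover F L K"
  shows "lie_isomorphic F (exterior_square F L) (lie_derived F K)"
proof -
  note L = assms(1) and fin_L = assms(2) and cover = assms(3)
  obtain M :: "('f, 'k) lie_algebra" where M: "defining_pair F L K M"
    using cover unfolding lie_cover_def by blast
  then have K: "lie_algebra F K" by (simp add: defining_pair_def)
  from M obtain i p where p: "p \<in> lie_hom F K L" and surj: "p ` carrier K = carrier L"
    and ker_i: "i ` carrier M = {x \<in> carrier K. p x = \<zero>\<^bsub>L\<^esub>}"
    and i: "i ` carrier M \<subseteq> lie_center K \<inter> carrier (lie_derived F K)"
    unfolding defining_pair_def by (elim exE conjE) (rule that)
  have ker: "{x \<in> carrier K. p x = \<zero>\<^bsub>L\<^esub>} \<subseteq> lie_center K \<inter> carrier (lie_derived F K)"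
    using i unfolding ker_i .
  let ?T = "tensor_square F L" and ?gen = "\<lambda>l k. tensor_class F L (TGen l k)"
  interpret L: lie_algebra F L by fact
  interpret K: lie_algebra F K by fact
  have T: "lie_algebra F ?T" by (rule L.lie_algebra_tensor_square)
  interpret T: lie_algebra F ?T by (rule T)
  interpret p: linear_map F K L p by (rule lie_hom_linear_map[OF K L p])
  have central: "{x \<in> carrier K. p x = \<zero>\<^bsub>L\<^esub>} \<subseteq> lie_center K" using ker by auto
  obtain \<phi> where \<phi>: "\<phi> \<in> lie_hom F ?T K"
    and \<phi>_gen: "\<And>x y. \<lbrakk>x \<in> carrier K; y \<in> carrier K\<rbrakk> \<Longrightarrow> \<phi> (?gen (p x) (p y)) = \<lbrakk>x, y\<rbrakk>\<^bsub>K\<^esub>"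
    using commutator_lift[OF K L p surj central] by blast
  interpret \<phi>: linear_map F ?T K \<phi> by (rule lie_hom_linear_map[OF T K \<phi>])
  have image: "\<phi> ` carrier ?T = carrier (lie_derived F K)"
    by (rule commutator_lift_image[OF K L p surj \<phi> \<phi>_gen])
  \<comment> \<open>Here the stem condition gives finiteness: the kernel of \<open>p\<close> lies in
    the derived subalgebra, which is the image of the finite dimensional tensor square.\<close>
  have fin_K: "K.fin_dim"
    by (rule stem_extension_fin_dim[OF T.vectorspace_axioms L.tensor_square_fin_dim[OF fin_L]
          L.vectorspace_axioms fin_L \<phi>.linear_map_axioms p.linear_map_axioms surj])
      (use ker in \<open>unfold image, blast\<close>)
  let ?D = "diagonal_ideal F L"
  have diag_subset: "{?gen l l | l. l \<in> carrier L} \<subseteq> carrier ?T" by auto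
  have D: "subspace F ?D ?T"
    unfolding diagonal_ideal_def by (rule T.span_is_subspace[OF diag_subset])
  have diag_in_D: "?gen l l \<in> ?D" if "l \<in> carrier L" for l
    unfolding diagonal_ideal_def using that by (intro subsetD[OF T.in_own_span[OF diag_subset]]) blast
  have D_le: "?D \<subseteq> {t \<in> carrier ?T. \<phi> t = \<zero>\<^bsub>K\<^esub>}"
    unfolding diagonal_ideal_def
  proof (rule T.span_is_subset)
    show "submodule F {t \<in> carrier ?T. \<phi> t = \<zero>\<^bsub>K\<^esub>} ?T"
      using \<phi>.ker_is_submodule by (simp add: \<phi>.ker_def)
    show "{?gen l l | l. l \<in> carrier L} \<subseteq> {t \<in> carrier ?T. \<phi> t = \<zero>\<^bsub>K\<^esub>}"
    proof clarify
      fix l assume l: "l \<in> carrier L"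
      then obtain x where "x \<in> carrier K" "l = p x" using surj by blast
      then show "?gen l l \<in> carrier ?T \<and> \<phi> (?gen l l) = \<zero>\<^bsub>K\<^esub>"
        using l by (simp add: \<phi>_gen K.bracket_self)
    qed
  qed
  have ker_le: "t \<in> ?D" if t: "t \<in> carrier ?T" "\<phi> t = \<zero>\<^bsub>K\<^esub>" for t
  proof (rule ccontr)
    assume "t \<notin> ?D"
    then obtain f where f: "f \<in> carrier ?T \<rightarrow> carrier F"
      and f_add: "\<And>v w. \<lbrakk>v \<in> carrier ?T; w \<in> carrier ?T\<rbrakk> \<Longrightarrow> f (v \<oplus>\<^bsub>?T\<^esub> w) = f v \<oplus>\<^bsub>F\<^esub> f w"
      and f_smult: "\<And>c v. \<lbrakk>c \<in> carrier F; v \<in> carrier ?T\<rbrakk> \<Longrightarrow> f (c \<odot>\<^bsub>?T\<^esub> v) = c \<otimes>\<^bsub>F\<^esub> f v"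
      and f_D: "\<And>v. v \<in> ?D \<Longrightarrow> f v = \<zero>\<^bsub>F\<^esub>" and f_t: "f t = \<one>\<^bsub>F\<^esub>"
      using T.separating_functional[OF D t(1)] by blast
    have cocycle: "lie_cocycle F L (\<lambda>l k. f (?gen l k))"
      by (rule L.exterior_functional_cocycle[OF f f_add f_smult f_D[OF diag_in_D]])
    interpret f: lie_cocycle F L "\<lambda>l k. f (?gen l k)" by (rule cocycle)
    interpret pf: lie_cocycle F K "\<lambda>x y. f (?gen (p x) (p y))"
      by (rule lie_cocycle_pullback[OF K cocycle p])
    let ?E = "scalar_extension F K (\<lambda>x y. f (?gen (p x) (p y)))"
    have E: "lie_algebra F ?E" by (rule pf.lie_algebra_extension)
    interpret E: lie_algebra F ?E by (rule E)
    note ED = E.subspaceD[OF E.subspace_derived]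
    \<comment> \<open>The pair depends linearly on \<open>v\<close>, and for a generator it is the
      bracket of lifts of the two factors to the extension.\<close>
    have pair_derived: "(\<phi> v, f v) \<in> carrier (lie_derived F ?E)" if "v \<in> carrier ?T" for v
      using that
    proof (rule L.tensor_square_induct)
      have "f \<zero>\<^bsub>?T\<^esub> = \<zero>\<^bsub>F\<^esub>" using f_D T.subspaceD(2)[OF D] by blast
      then show "(\<phi> \<zero>\<^bsub>?T\<^esub>, f \<zero>\<^bsub>?T\<^esub>) \<in> carrier (lie_derived F ?E)" using ED(2) by simp
      show "(\<phi> (?gen l k), f (?gen l k)) \<in> carrier (lie_derived F ?E)"
        if lk: "l \<in> carrier L" "k \<in> carrier L" for l k
      proof -
        obtain x y where "x \<in> carrier K" "y \<in> carrier K" "l = p x" "k = p y"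
          using lk surj by blast
        then show ?thesis
          using E.bracket_in_derived[of "(x, \<zero>\<^bsub>F\<^esub>)" "(y, \<zero>\<^bsub>F\<^esub>)"] by (simp add: \<phi>_gen)
      qed
      show "(\<phi> (v \<oplus>\<^bsub>?T\<^esub> w), f (v \<oplus>\<^bsub>?T\<^esub> w)) \<in> carrier (lie_derived F ?E)"
        if "v \<in> carrier ?T" "w \<in> carrier ?T" "(\<phi> v, f v) \<in> carrier (lie_derived F ?E)"
          "(\<phi> w, f w) \<in> carrier (lie_derived F ?E)" for v w
        using ED(3)[OF that(3,4)] that(1,2) by (simp add: f_add)
      show "(\<phi> (c \<odot>\<^bsub>?T\<^esub> v), f (c \<odot>\<^bsub>?T\<^esub> v)) \<in> carrier (lie_derived F ?E)"
        if "c \<in> carrier F" "v \<in> carrier ?T" "(\<phi> v, f v) \<in> carrier (lie_derived F ?E)" for c v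
        using ED(4)[OF that(1,3)] that(1,2) by (simp add: f_smult)
    qed
    have q: "p \<circ> fst \<in> lie_hom F ?E L" by (rule lie_hom_comp[OF pf.fst_lie_hom p])
    have q_surj: "(p \<circ> fst) ` carrier ?E = carrier L"
    proof -
      have "fst ` carrier ?E = carrier K" by auto
      then show ?thesis using surj by (simp only: image_comp[symmetric])
    qed
    have q_ker: "{e \<in> carrier ?E. (p \<circ> fst) e = \<zero>\<^bsub>L\<^esub>} \<subseteq> lie_center ?E \<inter> carrier (lie_derived F ?E)"
    proof
      fix e assume "e \<in> {e \<in> carrier ?E. (p \<circ> fst) e = \<zero>\<^bsub>L\<^esub>}"
      then obtain x a where e: "e = (x, a)" and x: "x \<in> carrier K" "p x = \<zero>\<^bsub>L\<^esub>" and a: "a \<in> carrier F"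
        by auto
      have x_central: "x \<in> lie_center K" using x by (intro subsetD[OF central]) simp
      \<comment> \<open>The form sees only \<open>p x\<close>, which is zero, so the centrality of
        \<open>x\<close> in \<open>K\<close> carries over to the extension.\<close>
      have "\<lbrakk>(x, a), (y, b)\<rbrakk>\<^bsub>?E\<^esub> = \<zero>\<^bsub>?E\<^esub>" if "y \<in> carrier K" for y b
        using x_central f.cocycle_zero_left[of "p y"] x(2) that by (simp add: lie_center_def)
      then have "e \<in> lie_center ?E"
        unfolding e lie_center_def using x(1) a by auto
      moreover have "e \<in> carrier (lie_derived F ?E)"
      proof -
        have "x \<in> lie_center K \<inter> carrier (lie_derived F K)" using x by (intro subsetD[OF ker]) simp
        then have "x \<in> \<phi> ` carrier ?T" unfolding image by (rule IntD2)
        then obtain v where v: "v \<in> carrier ?T" "\<phi> v = x" by (rule imageE) simp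
        have fv: "f v \<in> carrier F" by (rule funcset_mem[OF f v(1)])
        \<comment> \<open>The pair of \<open>v\<close> has the right first coordinate
          \<open>x\<close>, but the scalar \<open>f v\<close> in place of \<open>a\<close>;
          \<open>c\<close> is the multiple of \<open>(0, 1)\<close> that makes up the
          difference.\<close>
        define c where "c = a \<oplus>\<^bsub>F\<^esub> \<ominus>\<^bsub>F\<^esub> f v"
        have c: "c \<in> carrier F" using a fv by (simp add: c_def)
        have "(\<zero>\<^bsub>K\<^esub>, \<one>\<^bsub>F\<^esub>) \<in> carrier (lie_derived F ?E)" using pair_derived[OF t(1)] t(2) f_t by simp
        from ED(3)[OF ED(4)[OF c this] pair_derived[OF v(1)]]
        have "(x, c \<oplus>\<^bsub>F\<^esub> f v) \<in> carrier (lie_derived F ?E)" using c x(1) v(2) by simp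
        moreover have "c \<oplus>\<^bsub>F\<^esub> f v = a" using a fv by (simp add: c_def L.R.a_assoc L.R.l_neg)
        ultimately show ?thesis by (simp add: e)
      qed
      ultimately show "e \<in> lie_center ?E \<inter> carrier (lie_derived F ?E)" by simp
    qed
    have "E.dim \<le> K.dim"
      by (rule lie_cover_dim_max[OF L cover E pf.extension_dim(1)[OF fin_K] q q_surj q_ker])
    then show False using pf.extension_dim(2)[OF fin_K] by simp
  qed
  \<comment> \<open>The diagonal span, introduced only as a subspace, is now a kernel and hence an
    ideal, so the quotient by it falls under the first isomorphism theorem.\<close>
  have "?D = {t \<in> carrier ?T. \<phi> t = \<zero>\<^bsub>K\<^esub>}" using D_le ker_le by auto
  from lie_first_isomorphism[OF T K \<phi> this]
  have "lie_isomorphic F (exterior_square F L) (K\<lparr>carrier := carrier (lie_derived F K)\<rparr>)"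
    by (simp add: exterior_square_def image)
  moreover have "K\<lparr>carrier := carrier (lie_derived F K)\<rparr> = lie_derived F K"
    by (simp add: lie_derived_def)
  ultimately show ?thesis by simp
qed

end
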